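(* Let $k\geq 0$ and $n\geq k+1$ be integers. Then the function $x\mapsto(-1)^{n-1}R_{2,2n}(x)$ is completely monotonic of order $k$ on $(0,\infty)$.
   Context: The double Bernoulli polynomials $B_{2,k}(x)$ are defined by $$\frac{t^2e^{xt}}{(e^t-1)^2}=\sum_{k=0}^\infty B_{2,k}(x)\frac{t^k}{k!},$$ and the double Bernoulli numbers are $B_{2,k}=B_{2,k}(0)$. For an integer $M\geq 2$ and $w>0$, $R_{2,M}(w)$ is the remainder in the asymptotic expansion (due to Ruijsenaars) of the logarithm of the Barnes double gamma function $\Gamma_2(w)=\Gamma_2(w|1,1)$ with both parameters equal to $1$: $$\log\Gamma_2(w)=-\frac{B_{2,2}(w)}{2}\log w+\frac34 B_{2,0}w^2+B_{2,1}w+\sum_{k=3}^{M}\frac{(-1)^k}{k!}(k-3)!\,B_{2,k}w^{2-k}+R_{2,M}(w),$$ and it is given by $$R_{2,M}(w)=\int_0^\infty\frac{e^{-wt}}{t^3}\left(\frac{t^2}{(1-e^{-t})^2}-\sum_{k=0}^{M}\frac{(-1)^k}{k!}B_{2,k}t^k\right)dt.$$ This integral formula may be taken as the definition of $R_{2,M}$. A function $g:(0,\infty)\to\mathbb{R}$ is completely monotonic if it has derivatives of all orders and $(-1)^m g^{(m)}(x)\geq 0$ for all $x>0$ and $m=0,1,2,\ldots$. For $r\geq 0$, a function $f$ on $(0,\infty)$ is completely monotonic of order $r$ if $x\mapsto x^r f(x)$ is completely monotonic. *)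

theory Defs
  imports "HOL-Analysis.Analysis"
begin

definition double_bernpoly :: "nat \<Rightarrow> real \<Rightarrow> real" where
  "double_bernpoly k x =
     fact k * fps_nth (fps_X ^ 2 * fps_exp x / (fps_exp 1 - 1) ^ 2) k"

text \<open>The quotient of formal power series above is exact, since both sides have order 2,
  so the double Bernoulli polynomials do have the prescribed generating series.\<close>

lemma double_bernpoly_generating:
  "Abs_fps (\<lambda>k. double_bernpoly k x / fact k) * (fps_exp 1 - 1) ^ 2
     = fps_X ^ 2 * fps_exp (x::real)"
proof -
  have c1: "fps_nth (fps_exp (1::real) - 1) 1 \<noteq> 0" by simp
  have nz: "fps_exp (1::real) - 1 \<noteq> 0" using c1 by (metis fps_zero_nth)
  have "subdegree (fps_exp (1::real) - 1) \<le> 1"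
    using c1 by (rule subdegree_leI)
  hence "subdegree ((fps_exp (1::real) - 1) ^ 2) \<le> 2"
    by (simp add: subdegree_power)
  moreover have "subdegree (fps_X ^ 2 * fps_exp x) = 2"
    by simp
  ultimately have "(fps_exp 1 - 1) ^ 2 dvd fps_X ^ 2 * fps_exp x"
    using nz by (simp add: fps_dvd_iff)
  moreover have "Abs_fps (\<lambda>k. double_bernpoly k x / fact k)
      = fps_X ^ 2 * fps_exp x / (fps_exp 1 - 1) ^ 2"
    by (simp add: fps_eq_iff double_bernpoly_def)
  ultimately show ?thesis by simp
qed

abbreviation double_bernoulli :: "nat \<Rightarrow> real" where
  "double_bernoulli k \<equiv> double_bernpoly k 0"

definition double_gamma_remainder :: "nat \<Rightarrow> real \<Rightarrow> real" where
  "double_gamma_remainder M w =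
     (LINT t:{0<..}|lborel. exp (- w * t) / t ^ 3 *
        (t ^ 2 / (1 - exp (- t)) ^ 2 -
         (\<Sum>k=0..M. (- 1) ^ k / fact k * double_bernoulli k * t ^ k)))"

text \<open>A function on \<open>(0,\<infinity>)\<close> is represented by a total function on the reals, whose values
  outside \<open>(0,\<infinity>)\<close> are irrelevant: on this open set \<^const>\<open>deriv\<close> depends only on the values
  inside it.\<close>

definition completely_monotonic :: "(real \<Rightarrow> real) \<Rightarrow> bool" where
  "completely_monotonic g \<longleftrightarrow>
     (\<forall>m. \<forall>x>0. (deriv ^^ m) g field_differentiable (at x)) \<and>
     (\<forall>m. \<forall>x>0. (- 1) ^ m * (deriv ^^ m) g x \<ge> 0)"

definition completely_monotonic_of_order :: "real \<Rightarrow> (real \<Rightarrow> real) \<Rightarrow> bool" where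
  "completely_monotonic_of_order r f \<longleftrightarrow> completely_monotonic (\<lambda>x. x powr r * f x)"

end

theory Submission
  imports Defs
begin

text \<open>
  Put \<open>b(t) = 1/(1 - e\<^sup>-\<^sup>t)\<close>. Since \<open>b\<^sup>2 = b - b'\<close>, the partial fraction expansion of \<open>b\<close>, whose poles
  are \<open>\<plusminus>ia\<close> with \<open>a = 2\<pi>j\<close>, \<open>j \<ge> 1\<close>, and its derivative give, with \<open>m = n - 1\<close>,
  \<open>(-1)\<^sup>m R\<^sub>2\<^sub>,\<^sub>2\<^sub>n(x) = \<integral>\<^sub>0\<^sup>\<infinity> e\<^sup>-\<^sup>x\<^sup>t \<Sum>\<^sub>a p\<^sub>a(t) dt\<close> with rational functions \<open>p\<^sub>a\<close> that vanish to order at least \<open>m\<close>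
  at 0. If \<open>p\<^sub>a\<^sup>(\<^sup>k\<^sup>) \<ge> 0\<close> for \<open>k \<le> m\<close>, then integration by parts moves \<open>x\<^sup>k\<close> onto \<open>p\<^sub>a\<close>, so that
  \<open>(-1)\<^sup>m x\<^sup>k R\<^sub>2\<^sub>,\<^sub>2\<^sub>n(x)\<close> is the Laplace transform of a nonnegative function.
  Positivity of the derivatives comes from the identity
  \<open>(d/ds)\<^sup>m [s\<^sup>m\<^sup>+\<^sup>i (1 - Re (1 + is)\<^sup>-\<^sup>i\<^sup>-\<^sup>1)] = (m+i)!/i! s\<^sup>i (1 - Re (1 + is)\<^sup>-\<^sup>m\<^sup>-\<^sup>i\<^sup>-\<^sup>1)\<close>, since \<open>p\<^sub>a(as)\<close> is for
  \<open>m \<ge> 2\<close> a combination of such functions (with \<open>i = 0, 1\<close>) times powers of \<open>s\<close>, with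
  nonnegative coefficients.
\<close>

section \<open>Iterated antiderivatives of nonnegative functions\<close>

text \<open>\<open>repeated_integral h k f\<close> means \<open>f\<^sup>(\<^sup>k\<^sup>) = h\<close> on \<open>[0,\<infinity>)\<close> and \<open>f\<^sup>(\<^sup>j\<^sup>)(0) = 0\<close> for \<open>j < k\<close>.\<close>


inductive repeated_integral :: "(real \<Rightarrow> real) \<Rightarrow> nat \<Rightarrow> (real \<Rightarrow> real) \<Rightarrow> bool"
  for h :: "real \<Rightarrow> real" where
  zero: "repeated_integral h 0 f" if "\<And>t. t \<ge> 0 \<Longrightarrow> f t = h t"
| Suc: "repeated_integral h (Suc k) f"
  if "f 0 = 0" "\<And>t. t \<ge> 0 \<Longrightarrow> (f has_real_derivative f' t) (at t within {0..})"
    "repeated_integral h k f'"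


text \<open>The \<open>k\<close>-th derivative stays unnamed, so that sums, powers of
  \<open>t\<close> and rescalings can be treated without tracking it. Its continuity later supplies
  measurability.\<close>

inductive repeated_nonneg_integral :: "nat \<Rightarrow> (real \<Rightarrow> real) \<Rightarrow> bool" where
  zero: "repeated_nonneg_integral 0 f"
  if "continuous_on {0..} f" "\<And>t. t \<ge> 0 \<Longrightarrow> 0 \<le> f t"
| Suc: "repeated_nonneg_integral (Suc k) f"
  if "f 0 = 0" "\<And>t. t \<ge> 0 \<Longrightarrow> (f has_real_derivative f' t) (at t within {0..})"
    "repeated_nonneg_integral k f'"

inductive_cases repeated_integral_zeroE: "repeated_integral h 0 f"
inductive_cases repeated_integral_SucE: "repeated_integral h (Suc k) f"
inductive_cases repeated_nonneg_integral_zeroE: "repeated_nonneg_integral 0 f"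
inductive_cases repeated_nonneg_integral_SucE: "repeated_nonneg_integral (Suc k) f"

lemma repeated_integral_cong:
  assumes "repeated_integral h k f" "\<And>t. t \<ge> 0 \<Longrightarrow> h t = e t"
  shows "repeated_integral e k f"
  using assms(1)
proof induction
  case (zero f)
  then show ?case using assms(2) by (simp add: repeated_integral.zero)
next
  case (Suc f f' k)
  then show ?case by (intro repeated_integral.Suc)
qed

lemma repeated_nonneg_integralI:
  assumes "repeated_integral h k f" "continuous_on {0..} h" "\<And>t. t \<ge> 0 \<Longrightarrow> 0 \<le> h t"
  shows "repeated_nonneg_integral k f"
  using assms(1)
proof induction
  case (zero f)
  then have "continuous_on {0..} f \<longleftrightarrow> continuous_on {0..} h"
    by (intro continuous_on_cong) auto
  then show ?case using zero assms(2,3) by (intro repeated_nonneg_integral.zero) auto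
next
  case (Suc f f' k)
  then show ?case by (intro repeated_nonneg_integral.Suc)
qed

lemma repeated_integral_add:
  assumes "repeated_integral h k f" "repeated_integral e k g"
  shows "repeated_integral (\<lambda>t. h t + e t) k (\<lambda>t. f t + g t)"
  using assms
proof (induction arbitrary: g)
  case (zero f)
  from zero(2) show ?case
    by (rule repeated_integral_zeroE) (use zero(1) in \<open>auto intro: repeated_integral.zero\<close>)
next
  case (Suc f f' k)
  from Suc.prems show ?case
  proof (rule repeated_integral_SucE)
    fix g' assume g: "g 0 = 0" "\<And>t. 0 \<le> t \<Longrightarrow> (g has_real_derivative g' t) (at t within {0..})"
      "repeated_integral e k g'"
    show ?thesis
      by (rule repeated_integral.Suc[OF _ DERIV_add[OF Suc.hyps(2) g(2)] Suc.IH[OF g(3)]])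
        (use Suc.hyps(1) g(1) in auto)
  qed
qed

text \<open>Leibniz: \<open>(t f)\<^sup>(\<^sup>k\<^sup>+\<^sup>1\<^sup>) = t f\<^sup>(\<^sup>k\<^sup>+\<^sup>1\<^sup>) + (k+1) f\<^sup>(\<^sup>k\<^sup>)\<close> with \<open>f\<^sup>(\<^sup>k\<^sup>) = h\<close>.\<close>

lemma repeated_integral_times:
  assumes "repeated_integral h k f"
    and h': "\<And>t. t \<ge> 0 \<Longrightarrow> (h has_real_derivative h' t) (at t within {0..})"
  shows "repeated_integral (\<lambda>t. t * h' t + real (Suc k) * h t) (Suc k) (\<lambda>t. t * f t)"
  using assms(1)
proof induction
  case (zero f)
  have "(f has_real_derivative h' t) (at t within {0..})" if "t \<ge> 0" for t
    by (rule has_field_derivative_transform_within[OF h'[OF that], of 1]) (use zero that in auto)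
  then have "((\<lambda>t. t * f t) has_real_derivative (t * h' t + h t)) (at t within {0..})" if "t \<ge> 0" for t
    using that zero by (auto intro!: derivative_eq_intros)
  then show ?case by (rule repeated_integral.Suc[rotated]) (auto intro: repeated_integral.zero)
next
  case (Suc f f' k)
  have "repeated_integral (\<lambda>t. (t * h' t + real (Suc k) * h t) + h t) (Suc k) (\<lambda>t. t * f' t + f t)"
    by (rule repeated_integral_add[OF Suc.IH repeated_integral.Suc[OF Suc.hyps]])
  then have *: "repeated_integral (\<lambda>t. t * h' t + real (Suc (Suc k)) * h t) (Suc k) (\<lambda>t. t * f' t + f t)"
    by (rule repeated_integral_cong) (auto simp: algebra_simps)
  have "((\<lambda>t. t * f t) has_real_derivative (t * f' t + f t)) (at t within {0..})" if "t \<ge> 0" for t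
    using that by (auto intro!: derivative_eq_intros Suc.hyps)
  then show ?case by (rule repeated_integral.Suc[rotated]) (use * in auto)
qed

text \<open>A function that vanishes at 0 and has a nonnegative derivative is nonnegative. The
  induction only serves to reach the top of the chain of derivatives, where this is applied.\<close>

lemma repeated_nonneg_integral_Suc:
  assumes "repeated_nonneg_integral (Suc k) f"
  shows "repeated_nonneg_integral k f"
  using assms
proof (induction k arbitrary: f)
  case 0
  then obtain f' where f': "f 0 = 0" "\<And>t. t \<ge> 0 \<Longrightarrow> (f has_real_derivative f' t) (at t within {0..})"
    "\<And>t. t \<ge> 0 \<Longrightarrow> 0 \<le> f' t"
    by (elim repeated_nonneg_integral_SucE repeated_nonneg_integral_zeroE) blast
  have cont: "continuous_on {0..} f"
    by (rule DERIV_continuous_on[of _ _ f']) (use f'(2) in auto)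
  moreover have "0 \<le> f t" if "t \<ge> 0" for t
  proof -
    have "(f has_real_derivative f' s) (at s)" if "0 < s" for s
      using f'(2)[of s] that at_within_interior[of s "{0..}"] by simp
    moreover have "continuous_on {0..t} f" using cont by (rule continuous_on_subset) auto
    ultimately have "f 0 \<le> f t"
      by (intro DERIV_nonneg_imp_increasing_open[OF that] exI[of _ "f' _"] conjI f'(3) less_imp_le)
    then show ?thesis using f'(1) by simp
  qed
  ultimately show ?case by (rule repeated_nonneg_integral.zero)
next
  case (Suc k)
  from Suc.prems show ?case
    by (rule repeated_nonneg_integral_SucE) (rule repeated_nonneg_integral.Suc, auto intro: Suc.IH)
qed

lemma repeated_nonneg_integral_mono:
  assumes "repeated_nonneg_integral m f" "k \<le> m"
  shows "repeated_nonneg_integral k f"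
  using assms(2,1) by (induction rule: inc_induct) (simp, rule repeated_nonneg_integral_Suc)

lemma repeated_nonneg_integral_add:
  assumes "repeated_nonneg_integral k f" "repeated_nonneg_integral k g"
  shows "repeated_nonneg_integral k (\<lambda>t. f t + g t)"
  using assms
proof (induction arbitrary: g)
  case (zero f)
  from zero(3) show ?case
    by (rule repeated_nonneg_integral_zeroE)
      (rule repeated_nonneg_integral.zero, simp_all add: zero(1,2) continuous_on_add)
next
  case (Suc f f' k)
  from Suc.prems show ?case
  proof (rule repeated_nonneg_integral_SucE)
    fix g' assume g: "g 0 = 0" "\<And>t. 0 \<le> t \<Longrightarrow> (g has_real_derivative g' t) (at t within {0..})"
      "repeated_nonneg_integral k g'"
    show ?thesis
      by (rule repeated_nonneg_integral.Suc[OF _ DERIV_add[OF Suc.hyps(2) g(2)] Suc.IH[OF g(3)]])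
        (use Suc.hyps(1) g(1) in auto)
  qed
qed

lemma repeated_nonneg_integral_cmult:
  assumes "repeated_nonneg_integral k f" "c \<ge> 0"
  shows "repeated_nonneg_integral k (\<lambda>t. c * f t)"
  using assms(1)
proof induction
  case (zero f)
  then show ?case using assms(2)
    by (intro repeated_nonneg_integral.zero continuous_on_mult continuous_on_const) auto
next
  case (Suc f f' k)
  show ?case
    by (rule repeated_nonneg_integral.Suc[OF _ DERIV_cmult[OF Suc.hyps(2)] Suc.IH])
      (use Suc.hyps(1) in auto)
qed

text \<open>In \<open>(t f)' = t f' + f\<close> the first summand falls under the induction
  hypothesis, while \<open>f\<close> itself has one order to spare.\<close>

lemma repeated_nonneg_integral_times:
  assumes "repeated_nonneg_integral k f"
  shows "repeated_nonneg_integral k (\<lambda>t. t * f t)"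
  using assms
proof induction
  case (zero f)
  then show ?case
    by (intro repeated_nonneg_integral.zero continuous_on_mult continuous_on_id) auto
next
  case (Suc f f' k)
  have *: "repeated_nonneg_integral k (\<lambda>t. t * f' t + f t)"
    by (rule repeated_nonneg_integral_add[OF Suc.IH
          repeated_nonneg_integral_Suc[OF repeated_nonneg_integral.Suc[OF Suc.hyps]]])
  have "((\<lambda>t. t * f t) has_real_derivative (t * f' t + f t)) (at t within {0..})" if "t \<ge> 0" for t
    using that by (auto intro!: derivative_eq_intros Suc.hyps)
  then show ?case by (rule repeated_nonneg_integral.Suc[rotated]) (use * in auto)
qed

lemma repeated_nonneg_integral_power:
  assumes "repeated_nonneg_integral k f"
  shows "repeated_nonneg_integral k (\<lambda>t. t ^ i * f t)"
proof (induction i)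
  case (Suc i)
  then show ?case using repeated_nonneg_integral_times[OF Suc] by (simp add: mult.assoc)
qed (simp add: assms)

lemma repeated_nonneg_integral_rescale:
  assumes "repeated_nonneg_integral k f" "a > 0"
  shows "repeated_nonneg_integral k (\<lambda>t. f (t / a))"
  using assms(1)
proof induction
  case (zero f)
  have "continuous_on {0..} (\<lambda>t. f (t / a))"
    by (rule continuous_on_compose2[of "{0..}" f])
      (use zero(1) assms(2) in \<open>auto intro!: continuous_on_divide continuous_on_id continuous_on_const\<close>)
  then show ?case using zero(2) assms(2) by (intro repeated_nonneg_integral.zero) simp_all
next
  case (Suc f f' k)
  have "((\<lambda>t. f (t / a)) has_real_derivative (f' (t / a) * (1 / a))) (at t within {0..})" if "t \<ge> 0" for t
  proof -
    have "(f has_real_derivative f' (t / a)) (at (t / a) within (\<lambda>t. t / a) ` {0..})"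
      by (rule DERIV_subset[OF Suc.hyps(2)]) (use that assms(2) in auto)
    moreover have "((\<lambda>t. t / a) has_real_derivative 1 / a) (at t within {0..})"
      using assms(2) by (auto intro!: derivative_eq_intros)
    ultimately show ?thesis by (rule DERIV_image_chain[of f _ "\<lambda>t. t / a", unfolded o_def])
  qed
  moreover have "repeated_nonneg_integral k (\<lambda>t. f' (t / a) * (1 / a))"
    using repeated_nonneg_integral_cmult[OF Suc.IH, of "1/a"] assms(2) by (simp add: mult.commute)
  ultimately show ?case using Suc.hyps(1) by (intro repeated_nonneg_integral.Suc) simp_all
qed


section \<open>The rational kernels\<close>

lemma Re_inverse_power_derivative:
  "((\<lambda>t. Re (1 / (1 + \<i> * of_real t) ^ n)) has_real_derivative
     real n * Im (1 / (1 + \<i> * of_real t) ^ Suc n)) (at t within A)"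
proof -
  have nz: "1 + \<i> * complex_of_real t \<noteq> 0" by (auto simp: complex_eq_iff)
  \<comment> \<open>The left side is the form in which the quotient rule delivers the derivative;
    its exponent \<open>n - 1\<close> makes \<open>n = 0\<close> a separate case.\<close>
  have eq: "- (of_nat n * w ^ (n - 1) * u / (w ^ n * w ^ n)) = - (u * of_nat n / w ^ Suc n)"
    if "w \<noteq> 0" for u w :: complex
    using that by (cases n) (auto simp: field_simps)
  have "((\<lambda>z. 1 / (1 + \<i> * z) ^ n) has_field_derivative
      - (\<i> * of_nat n / (1 + \<i> * of_real t) ^ Suc n)) (at (of_real t))"
    using nz eq[OF nz, of \<i>]
    by (auto intro!: derivative_eq_intros simp: mult_ac)
  then have "((\<lambda>t. Re (1 / (1 + \<i> * of_real t) ^ n)) has_real_derivative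
     Re (- (\<i> * of_nat n / (1 + \<i> * of_real t) ^ Suc n))) (at t within A)"
    by (intro has_field_derivative_Re has_vector_derivative_real_field)
  also have "Re (- (\<i> * of_nat n / w)) = real n * Im (1 / w)" for w
    by (simp add: Re_divide Im_divide)
  finally show ?thesis .
qed

text \<open>Take real parts in \<open>(1 + it)^(-n) = (1 + it) (1 + it)^(-n-1)\<close>. Passing to
  the higher power lets imaginary parts cancel in \<open>repeated_integral_base\<close>.\<close>

lemma Re_inverse_power_rec:
  "Re (1 / (1 + \<i> * of_real t) ^ n) =
     Re (1 / (1 + \<i> * of_real t) ^ Suc n) - t * Im (1 / (1 + \<i> * of_real t) ^ Suc n)"
proof -
  have nz: "1 + \<i> * complex_of_real t \<noteq> 0" by (auto simp: complex_eq_iff)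
  define w where "w = 1 / (1 + \<i> * of_real t) ^ Suc n"
  have "1 / (1 + \<i> * of_real t) ^ n = (1 + \<i> * of_real t) * w"
    using nz by (simp add: w_def)
  also have "Re \<dots> = Re w - t * Im w" by simp
  finally show ?thesis unfolding w_def .
qed

lemma Re_inverse_power_le_1: "Re (1 / (1 + \<i> * of_real t) ^ n) \<le> 1"
proof -
  have "1 \<le> cmod (1 + \<i> * of_real t)" using abs_Re_le_cmod[of "1 + \<i> * of_real t"] by simp
  then have "1 \<le> cmod (1 + \<i> * of_real t) ^ n" by (rule one_le_power)
  then have "cmod (1 / (1 + \<i> * of_real t) ^ n) \<le> 1"
    by (simp add: norm_divide norm_power divide_le_eq)
  then show ?thesis using complex_Re_le_cmod order_trans by blast
qed

text \<open>Multiplication by \<open>t\<close> raises \<open>k\<close> by one, and the Leibniz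
  formula yields the new top derivative. The imaginary part produced by differentiation cancels
  against the one from \<open>Re_inverse_power_rec\<close>, which leaves a function of the same
  shape.\<close>

lemma repeated_integral_base:
  "repeated_integral
     (\<lambda>t. fact (k + i) / fact i * (t ^ i * (1 - Re (1 / (1 + \<i> * of_real t) ^ Suc (k + i)))))
     k (\<lambda>t. t ^ (k + i) * (1 - Re (1 / (1 + \<i> * of_real t) ^ Suc i)))"
proof (induction k)
  case 0
  then show ?case by (intro repeated_integral.zero) simp
next
  case (Suc k)
  let ?y = "\<lambda>n t. 1 / (1 + \<i> * complex_of_real t) ^ n"
  let ?K = "fact (k + i) / fact i :: real"
  let ?h' = "\<lambda>t. ?K * ((real i * t ^ (i - 1)) * (1 - Re (?y (Suc (k + i)) t))
      + t ^ i * (- (real (Suc (k + i)) * Im (?y (Suc (Suc (k + i))) t))))"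
  have "((\<lambda>t. ?K * (t ^ i * (1 - Re (?y (Suc (k + i)) t)))) has_real_derivative ?h' t) (at t within {0..})" for t
    by (rule derivative_eq_intros Re_inverse_power_derivative refl)+ simp
  from repeated_integral_times[OF Suc.IH this]
  have *: "repeated_integral
     (\<lambda>t. t * ?h' t + real (Suc k) * (?K * (t ^ i * (1 - Re (?y (Suc (k + i)) t)))))
     (Suc k) (\<lambda>t. t * (t ^ (k + i) * (1 - Re (?y (Suc i) t))))" .
  have "t * ?h' t + real (Suc k) * (?K * (t ^ i * (1 - Re (?y (Suc (k + i)) t)))) =
     fact (Suc k + i) / fact i * (t ^ i * (1 - Re (?y (Suc (Suc k + i)) t)))" for t
  proof -
    define R where "R = Re (?y (Suc (Suc (k + i))) t)"
    define I where "I = Im (?y (Suc (Suc (k + i))) t)"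
    have R': "Re (?y (Suc (k + i)) t) = R - t * I"
      unfolding R_def I_def by (rule Re_inverse_power_rec)
    have p: "t * (real i * t ^ (i - 1)) = real i * t ^ i" by (cases i) auto
    \<comment> \<open>Here \<open>q\<close> and \<open>p\<close> stand for \<open>i t^(i-1)\<close>
      and \<open>t^i\<close>, \<open>a\<close> for \<open>i\<close> and \<open>c\<close> for
      \<open>k + 1\<close>. Up to the factor \<open>K\<close>, the coefficients of
      \<open>p t I\<close> are \<open>a\<close>, \<open>-(a + c)\<close> and \<open>c\<close>, which
      add up to 0.\<close>
    have alg: "t * (K * (q * (1 - (R - t * I)) + p * (- ((a + c) * I)))) + c * (K * (p * (1 - (R - t * I)))) =
        (a + c) * K * (p * (1 - R))" if "t * q = a * p" for K q p a c :: real
    proof -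
      have "t * (K * (q * (1 - (R - t * I)) + p * (- ((a + c) * I)))) + c * (K * (p * (1 - (R - t * I)))) =
          K * ((t * q) * (1 - (R - t * I)) - p * (a + c) * (t * I) + c * (p * (1 - (R - t * I))))"
        by (simp add: algebra_simps)
      also have "\<dots> = (a + c) * K * (p * (1 - R))"
        unfolding that by (simp add: algebra_simps)
      finally show ?thesis .
    qed
    have N: "real (Suc (k + i)) = real i + real (Suc k)" by simp
    have "t * ?h' t + real (Suc k) * (?K * (t ^ i * (1 - Re (?y (Suc (k + i)) t)))) =
        (real i + real (Suc k)) * ?K * (t ^ i * (1 - R))"
      unfolding R' I_def[symmetric] N by (rule alg[OF p])
    also have "(real i + real (Suc k)) * ?K = fact (Suc k + i) / fact i" by simp
    finally show ?thesis unfolding R_def add_Suc .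
  qed
  from repeated_integral_cong[OF * this]
  have "repeated_integral (\<lambda>t. fact (Suc k + i) / fact i * (t ^ i * (1 - Re (?y (Suc (Suc k + i)) t))))
     (Suc k) (\<lambda>t. t * (t ^ (k + i) * (1 - Re (?y (Suc i) t))))" .
  moreover have "(\<lambda>t. t * (t ^ (k + i) * (1 - Re (?y (Suc i) t)))) = (\<lambda>t. t ^ (Suc k + i) * (1 - Re (?y (Suc i) t)))"
    by (simp only: add_Suc power_Suc[of _ "k + i"] mult.assoc)
  ultimately show ?case by (simp only:)
qed

text \<open>Nonnegativity of the top derivative comes from \<open>|1 + it| >= 1\<close>.\<close>

lemma repeated_nonneg_integral_base:
  "repeated_nonneg_integral k (\<lambda>t. t ^ (k + i) * (1 - Re (1 / (1 + \<i> * of_real t) ^ Suc i)))"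
proof (rule repeated_nonneg_integralI[OF repeated_integral_base])
  have nz: "1 + \<i> * complex_of_real t \<noteq> 0" for t by (auto simp: complex_eq_iff)
  show "continuous_on {0..} (\<lambda>t. fact (k + i) / fact i * (t ^ i * (1 - Re (1 / (1 + \<i> * of_real t) ^ Suc (k + i)))))"
    by (intro continuous_intros) (use nz in auto)
  show "0 \<le> fact (k + i) / fact i * (t ^ i * (1 - Re (1 / (1 + \<i> * of_real t) ^ Suc (k + i))))" if "t \<ge> 0" for t
    using that Re_inverse_power_le_1[of t "Suc (k + i)"] by (intro mult_nonneg_nonneg) auto
qed

text \<open>Up to scaling, the contributions of a pole pair \<open>\<plusminus>i\<close> to \<open>p\<^sub>a\<close>: \<open>even_kernel\<close> comes from the
  remainder of \<open>b\<close> and \<open>odd_kernel m s = (1/s) d/ds (s\<^sup>2\<^sup>m\<^sup>+\<^sup>3 / (1 + s\<^sup>2))\<close> from that of \<open>-b'\<close>.\<close>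

definition even_kernel :: "nat \<Rightarrow> real \<Rightarrow> real" where
  "even_kernel m s = s ^ (2 * m) / (1 + s\<^sup>2)"

definition odd_kernel :: "nat \<Rightarrow> real \<Rightarrow> real" where
  "odd_kernel m s = s ^ (2 * m + 1) *
     (2 * real m / (1 + s\<^sup>2) + (3 + s\<^sup>2) / (1 + s\<^sup>2)\<^sup>2)"

lemma one_plus_square_pos: "0 < 1 + (s::real)\<^sup>2"
  by (simp add: add_pos_nonneg)

lemma one_minus_Re_1: "1 - Re (1 / (1 + \<i> * of_real s) ^ Suc 0) = s\<^sup>2 / (1 + s\<^sup>2)"
proof -
  have "Re (1 / (1 + \<i> * of_real s) ^ Suc 0) = 1 / (1 + s\<^sup>2)" by (simp add: Re_divide)
  moreover have "1 - 1 / (1 + s\<^sup>2) = s\<^sup>2 / (1 + s\<^sup>2)"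
    using one_plus_square_pos[of s] by (simp add: diff_divide_eq_iff)
  ultimately show ?thesis by (simp only:)
qed

text \<open>The square is \<open>(1 - s^2) + 2is\<close>, with squared modulus
  \<open>(1 + s^2)^2\<close>. Factoring out \<open>s^2\<close> produces the second fraction of
  \<open>odd_kernel\<close>.\<close>

lemma one_minus_Re_2: "1 - Re (1 / (1 + \<i> * of_real s) ^ Suc (Suc 0)) = s\<^sup>2 * ((3 + s\<^sup>2) / (1 + s\<^sup>2)\<^sup>2)"
proof -
  have eq: "(1 + \<i> * complex_of_real s) ^ Suc (Suc 0) = Complex (1 - s\<^sup>2) (2 * s)"
    by (simp add: complex_eq_iff power2_eq_square)
  have "Re (1 / Complex (1 - s\<^sup>2) (2 * s)) = (1 - s\<^sup>2) / ((1 - s\<^sup>2)\<^sup>2 + (2 * s)\<^sup>2)"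
    by (simp add: Re_divide)
  also have "(1 - s\<^sup>2)\<^sup>2 + (2 * s)\<^sup>2 = (1 + s\<^sup>2)\<^sup>2" by (simp add: power2_eq_square algebra_simps)
  finally have R: "Re (1 / Complex (1 - s\<^sup>2) (2 * s)) = (1 - s\<^sup>2) / (1 + s\<^sup>2)\<^sup>2" .
  have "(1 + s\<^sup>2)\<^sup>2 \<noteq> 0" using one_plus_square_pos[of s] by simp
  then have "1 - (1 - s\<^sup>2) / (1 + s\<^sup>2)\<^sup>2 = ((1 + s\<^sup>2)\<^sup>2 - (1 - s\<^sup>2)) / (1 + s\<^sup>2)\<^sup>2"
    by (simp only: diff_divide_distrib[of "(1 + s\<^sup>2)\<^sup>2"] divide_self not_False_eq_True)
  also have "(1 + s\<^sup>2)\<^sup>2 - (1 - s\<^sup>2) = s\<^sup>2 * (3 + s\<^sup>2)"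
    by (simp add: power2_eq_square algebra_simps)
  finally show ?thesis unfolding eq R by (simp only: times_divide_eq_right)
qed


lemma repeated_nonneg_integral_one:
  assumes "f 0 = 0" "\<And>t. t \<ge> 0 \<Longrightarrow> (f has_real_derivative f' t) (at t within {0..})"
    "continuous_on {0..} f'" "\<And>t. t \<ge> 0 \<Longrightarrow> 0 \<le> f' t"
  shows "repeated_nonneg_integral 1 f"
  using repeated_nonneg_integral.Suc[OF assms(1,2) repeated_nonneg_integral.zero[OF assms(3,4)]]
  by simp

text \<open>For \<open>m = 1\<close> writing the kernels as powers of \<open>s\<close> times the functions of
  \<open>repeated_nonneg_integral_base\<close> would need negative exponents, so their derivatives are computed
  directly.\<close>

lemma even_kernel_repeated: "repeated_nonneg_integral m (even_kernel m)"
proof -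
  note pos = one_plus_square_pos
  consider "m = 0" | "m = 1" | j where "m = j + 2"
    by (metis One_nat_def add_2_eq_Suc' not0_implies_Suc)
  then show ?thesis
  proof cases
    case 1
    have "continuous_on {0..} (even_kernel 0)" unfolding even_kernel_def
      by (intro continuous_intros) (use pos in \<open>auto simp: less_imp_neq[symmetric] dest: less_imp_neq\<close>)
    then show ?thesis using 1 by (auto intro!: repeated_nonneg_integral.zero simp: even_kernel_def)
  next
    case 2
    have nz: "1 + s\<^sup>2 \<noteq> 0" for s :: real using pos[of s] by simp
    have "repeated_nonneg_integral 1 (even_kernel 1)"
    proof (rule repeated_nonneg_integral_one)
      show "(even_kernel 1 has_real_derivative 2 * t / (1 + t\<^sup>2)\<^sup>2) (at t within {0..})" for t
        unfolding even_kernel_def [abs_def] using nz[of t]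
        by (auto intro!: derivative_eq_intros simp: field_simps power2_eq_square)
      show "continuous_on {0..} (\<lambda>t::real. 2 * t / (1 + t\<^sup>2)\<^sup>2)"
        by (intro continuous_intros) (use nz in auto)
    qed (auto simp: even_kernel_def)
    then show ?thesis using 2 by simp
  next
    case 3
    \<comment> \<open>The exponents match, \<open>j + m + 2 = 2m\<close>, where the last 2 comes
      from \<open>s^2 / (1 + s^2)\<close>.\<close>
    have "even_kernel m = (\<lambda>s. s ^ j * (s ^ (m + 0) * (1 - Re (1 / (1 + \<i> * of_real s) ^ Suc 0))))"
      unfolding one_minus_Re_1 even_kernel_def 3 by (simp add: fun_eq_iff power_add mult_2 power2_eq_square)
    then show ?thesis
      by (simp only: repeated_nonneg_integral_power[OF repeated_nonneg_integral_base])
  qed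
qed

lemma odd_kernel_repeated: "repeated_nonneg_integral m (odd_kernel m)"
proof -
  note pos = one_plus_square_pos
  have nz: "1 + s\<^sup>2 \<noteq> 0" for s :: real using pos[of s] by simp
  consider "m = 0" | "m = 1" | j where "m = j + 2"
    by (metis One_nat_def add_2_eq_Suc' not0_implies_Suc)
  then show ?thesis
  proof cases
    case 1
    have "continuous_on {0..} (odd_kernel 0)" unfolding odd_kernel_def
      by (intro continuous_intros) (use nz in auto)
    then show ?thesis using 1 by (auto intro!: repeated_nonneg_integral.zero simp: odd_kernel_def)
  next
    case 2
    \<comment> \<open>The derivative is written as a sum of two visibly nonnegative fractions. In
      the second one a factor \<open>1 + t^2\<close> is cancelled and \<open>9 + 2t^2 + t^4\<close>
      is written as \<open>(1 + t^2)^2 + 8\<close>.\<close>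
    let ?f' = "\<lambda>t::real. 2 * (3 * t\<^sup>2 + t ^ 4) / (1 + t\<^sup>2)\<^sup>2 + t\<^sup>2 * ((1 + t\<^sup>2)\<^sup>2 + 8) / (1 + t\<^sup>2) ^ 3"
    have "repeated_nonneg_integral 1 (odd_kernel 1)"
    proof (rule repeated_nonneg_integral_one)
      show "(odd_kernel 1 has_real_derivative ?f' t) (at t within {0..})" for t
      proof -
        have eq: "odd_kernel 1 = (\<lambda>s. 2 * (s ^ 3 / (1 + s\<^sup>2)) + (3 * s ^ 3 + s ^ 5) / (1 + s\<^sup>2)\<^sup>2)"
          unfolding odd_kernel_def using nz by (auto simp: fun_eq_iff field_simps power_numeral_reduce)
        have d1: "((\<lambda>s. s ^ 3 / (1 + s\<^sup>2)) has_real_derivative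
            (3 * t\<^sup>2 + t ^ 4) / (1 + t\<^sup>2)\<^sup>2) (at t within {0..})"
          using nz[of t] by (auto intro!: derivative_eq_intros simp: power_numeral_reduce algebra_simps)
        have d2: "((\<lambda>s. (3 * s ^ 3 + s ^ 5) / (1 + s\<^sup>2)\<^sup>2) has_real_derivative
            ((9 * t\<^sup>2 + 5 * t ^ 4) * (1 + t\<^sup>2)\<^sup>2 - (3 * t ^ 3 + t ^ 5) * (2 * (1 + t\<^sup>2) * (2 * t))) /
            ((1 + t\<^sup>2)\<^sup>2 * (1 + t\<^sup>2)\<^sup>2)) (at t within {0..})"
          using nz[of t] by (auto intro!: derivative_eq_intros)
        have A: "(9 * t\<^sup>2 + 5 * t ^ 4) * (1 + t\<^sup>2)\<^sup>2 - (3 * t ^ 3 + t ^ 5) * (2 * (1 + t\<^sup>2) * (2 * t)) =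
            (1 + t\<^sup>2) * (t\<^sup>2 * ((1 + t\<^sup>2)\<^sup>2 + 8))"
          by (simp add: algebra_simps power_numeral_reduce)
        have B: "(1 + t\<^sup>2)\<^sup>2 * (1 + t\<^sup>2)\<^sup>2 = (1 + t\<^sup>2) * (1 + t\<^sup>2) ^ 3"
          by (simp add: power_numeral_reduce)
        have "((9 * t\<^sup>2 + 5 * t ^ 4) * (1 + t\<^sup>2)\<^sup>2 - (3 * t ^ 3 + t ^ 5) * (2 * (1 + t\<^sup>2) * (2 * t))) /
            ((1 + t\<^sup>2)\<^sup>2 * (1 + t\<^sup>2)\<^sup>2) = t\<^sup>2 * ((1 + t\<^sup>2)\<^sup>2 + 8) / (1 + t\<^sup>2) ^ 3"
          unfolding A B by (rule mult_divide_mult_cancel_left[OF nz])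
        with d2 have d2': "((\<lambda>s. (3 * s ^ 3 + s ^ 5) / (1 + s\<^sup>2)\<^sup>2) has_real_derivative
            t\<^sup>2 * ((1 + t\<^sup>2)\<^sup>2 + 8) / (1 + t\<^sup>2) ^ 3) (at t within {0..})"
          by (simp only:)
        show ?thesis unfolding eq using DERIV_add[OF DERIV_cmult[OF d1, of 2] d2'] by (simp only: times_divide_eq_right)
      qed
      show "continuous_on {0..} ?f'"
        by (intro continuous_intros) (use nz in auto)
    qed (auto simp: odd_kernel_def)
    then show ?thesis using 2 by simp
  next
    case 3
    \<comment> \<open>Both summands have total exponent \<open>2m + 1\<close>:
      \<open>(m - 1) + m + 2\<close> for the simple pole part and
      \<open>(m - 2) + (m + 1) + 2\<close> for the double pole part.\<close>
    have "odd_kernel m = (\<lambda>s. 2 * real m * (s ^ (m - 1) * (s ^ (m + 0) * (1 - Re (1 / (1 + \<i> * of_real s) ^ Suc 0))))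
        + s ^ (m - 2) * (s ^ (m + 1) * (1 - Re (1 / (1 + \<i> * of_real s) ^ Suc 1))))"
    proof
      fix s :: real
      have e: "s ^ (m - 1) * s ^ m * s\<^sup>2 = s ^ (2 * m + 1)" "s ^ (m - 2) * s ^ (m + 1) * s\<^sup>2 = s ^ (2 * m + 1)"
        unfolding power_add[symmetric] using 3 by (simp_all add: mult_2)
      have "odd_kernel m s = 2 * real m * (s ^ (m - 1) * s ^ m * s\<^sup>2 / (1 + s\<^sup>2))
          + (s ^ (m - 2) * s ^ (m + 1) * s\<^sup>2) * ((3 + s\<^sup>2) / (1 + s\<^sup>2)\<^sup>2)"
        unfolding e odd_kernel_def by (simp only: distrib_left times_divide_eq_right mult_ac)
      then show "odd_kernel m s = 2 * real m * (s ^ (m - 1) * (s ^ (m + 0) * (1 - Re (1 / (1 + \<i> * of_real s) ^ Suc 0))))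
        + s ^ (m - 2) * (s ^ (m + 1) * (1 - Re (1 / (1 + \<i> * of_real s) ^ Suc 1)))"
        unfolding one_minus_Re_1 One_nat_def one_minus_Re_2
        by (simp only: mult.assoc times_divide_eq_right add_0_right)
    qed
    moreover have "repeated_nonneg_integral m (\<lambda>s. 2 * real m * (s ^ (m - 1) * (s ^ (m + 0) * (1 - Re (1 / (1 + \<i> * of_real s) ^ Suc 0))))
        + s ^ (m - 2) * (s ^ (m + 1) * (1 - Re (1 / (1 + \<i> * of_real s) ^ Suc 1))))"
      by (intro repeated_nonneg_integral_add repeated_nonneg_integral_cmult
          repeated_nonneg_integral_power repeated_nonneg_integral_base) simp
    ultimately show ?thesis by (simp only:)
  qed
qed


section \<open>Laplace transforms and complete monotonicity\<close>

text \<open>A second-order Taylor bound for both signs of \<open>v\<close>, used for the difference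
  quotients of Laplace transforms. From \<open>1 - v <= exp (-v)\<close> the error is at most
  \<open>v * (exp v - 1)\<close>.\<close>

lemma exp_minus_linear_bound:
  fixes v :: real
  shows "\<bar>exp v - 1 - v\<bar> \<le> v\<^sup>2 * exp \<bar>v\<bar>"
proof -
  have "1 - v \<le> exp (- v)" using exp_ge_add_one_self[of "- v"] by simp
  then have "(1 - v) * exp v \<le> exp (- v) * exp v" by (rule mult_right_mono) simp
  also have "exp (- v) * exp v = 1" by (simp flip: exp_add)
  finally have 1: "exp v - 1 - v \<le> v * (exp v - 1)"
    unfolding left_diff_distrib right_diff_distrib by linarith
  have 2: "0 \<le> exp v - 1 - v" using exp_ge_add_one_self[of v] by linarith
  have "v * (exp v - 1) \<le> v\<^sup>2 * exp \<bar>v\<bar>"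
  proof (cases "v \<ge> 0")
    case True
    have "exp v - 1 \<le> v * exp v" using 1 by (simp add: algebra_simps)
    then have "v * (exp v - 1) \<le> v * (v * exp v)" using True by (rule mult_left_mono)
    then show ?thesis using True by (simp add: power2_eq_square mult.assoc)
  next
    case False
    have "1 - exp v \<le> - v" using exp_ge_add_one_self[of v] by linarith
    then have "(- v) * (1 - exp v) \<le> (- v) * (- v)"
      using False by (intro mult_left_mono) auto
    also have "\<dots> * 1 \<le> (- v) * (- v) * exp \<bar>v\<bar>"
      by (intro mult_left_mono) auto
    finally show ?thesis by (simp add: power2_eq_square algebra_simps)
  qed
  with 1 2 show ?thesis by simp
qed

text \<open>Extension by 0 to the negative axis lets all integrals run over the whole line.
  Convergence for every \<open>x > 0\<close> makes the class stable under multiplication by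
  \<open>t\<close>.\<close>

definition laplace_weight :: "(real \<Rightarrow> real) \<Rightarrow> bool" where
  "laplace_weight q \<longleftrightarrow> q \<in> borel_measurable borel \<and> (\<forall>t. 0 \<le> q t) \<and> (\<forall>t<0. q t = 0) \<and>
     (\<forall>x>0. integrable lborel (\<lambda>t. exp (- x * t) * q t))"

text \<open>Half of the exponential decay pays for the factor:
  \<open>t <= (2/x) exp (x t / 2)\<close>.\<close>

lemma laplace_weight_times:
  assumes "laplace_weight q"
  shows "laplace_weight (\<lambda>t. t * q t)"
  unfolding laplace_weight_def
proof (intro conjI allI impI)
  have q [measurable]: "q \<in> borel_measurable borel" using assms by (simp add: laplace_weight_def)
  show "(\<lambda>t. t * q t) \<in> borel_measurable borel" by measurable
  show "0 \<le> t * q t" for t using assms by (cases "t < 0") (auto simp: laplace_weight_def)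
  show "t * q t = 0" if "t < 0" for t using assms that by (auto simp: laplace_weight_def)
  fix x :: real assume x: "x > 0"
  then have "integrable lborel (\<lambda>t. exp (- (x / 2) * t) * q t)"
    using assms half_gt_zero unfolding laplace_weight_def by blast
  then have "integrable lborel (\<lambda>t. (2 / x) * (exp (- (x / 2) * t) * q t))"
    by (rule integrable_mult_right)
  then show "integrable lborel (\<lambda>t. exp (- x * t) * (t * q t))"
  proof (rule Bochner_Integration.integrable_bound)
    show "AE t in lborel. norm (exp (- x * t) * (t * q t)) \<le> norm (2 / x * (exp (- (x / 2) * t) * q t))"
    proof (rule AE_I2)
      fix t :: real
      show "norm (exp (- x * t) * (t * q t)) \<le> norm (2 / x * (exp (- (x / 2) * t) * q t))"
      proof (cases "t < 0")
        case True
        then show ?thesis using assms by (simp add: laplace_weight_def)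
      next
        case False
        have "x / 2 * t \<le> exp (x / 2 * t)"
          using exp_ge_add_one_self[of "x / 2 * t"] by linarith
        then have "t \<le> 2 / x * exp (x / 2 * t)" using x by (simp add: field_simps)
        then have "exp (- x * t) * t \<le> exp (- x * t) * (2 / x * exp (x / 2 * t))"
          by (rule mult_left_mono) simp
        also have "\<dots> = 2 / x * (exp (- x * t) * exp (x / 2 * t))" by (simp only: mult_ac)
        also have "exp (- x * t) * exp (x / 2 * t) = exp (- (x / 2) * t)"
          unfolding exp_add[symmetric] by (simp add: field_simps)
        finally have "exp (- x * t) * t * q t \<le> 2 / x * exp (- (x / 2) * t) * q t"
          using assms by (intro mult_right_mono) (auto simp: laplace_weight_def)
        then show ?thesis using False x assms by (simp add: laplace_weight_def abs_mult mult.assoc)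
      qed
    qed
  qed measurable
qed

lemma laplace_weight_power:
  assumes "laplace_weight q"
  shows "laplace_weight (\<lambda>t. t ^ m * q t)"
proof (induction m)
  case (Suc m)
  from laplace_weight_times[OF this] show ?case by (simp add: mult.assoc)
qed (use assms in simp)

text \<open>Differentiation under the integral with an explicit error: for \<open>|h| < x/2\<close>
  the factor \<open>exp (|h| t)\<close> is absorbed by half of the decay, so the difference quotient
  is off by at most \<open>|h|\<close> times the Laplace transform of \<open>t^2 q\<close> at
  \<open>x/2\<close>.\<close>

lemma laplace_weight_has_derivative:
  assumes w: "laplace_weight q" and x: "x > 0"
  shows "((\<lambda>x. LINT t|lborel. exp (- x * t) * q t) has_real_derivative
     - (LINT t|lborel. exp (- x * t) * (t * q t))) (at x)"
proof -
  have q0: "0 \<le> q t" for t using w by (simp add: laplace_weight_def)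
  have int: "integrable lborel (\<lambda>t. exp (- y * t) * q t)"
      "integrable lborel (\<lambda>t. exp (- y * t) * (t * q t))"
      "integrable lborel (\<lambda>t. exp (- y * t) * (t * (t * q t)))" if "y > 0" for y
    using w laplace_weight_times[OF w] laplace_weight_times[OF laplace_weight_times[OF w]] that
    unfolding laplace_weight_def by blast+
  let ?G = "\<lambda>x. LINT t|lborel. exp (- x * t) * q t"
  let ?D = "- (LINT t|lborel. exp (- x * t) * (t * q t))"
  define C where "C = (LINT t|lborel. exp (- (x / 2) * t) * (t * (t * q t)))"
  have bound: "\<bar>(?G (x + h) - ?G x) / h - ?D\<bar> \<le> \<bar>h\<bar> * C" if h: "h \<noteq> 0" "\<bar>h\<bar> < x / 2" for h
  proof -
    have xh: "x + h > 0" using h x by linarith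
    have pt: "norm (exp (- (x + h) * t) * q t - exp (- x * t) * q t + h * (exp (- x * t) * (t * q t)))
        \<le> h\<^sup>2 * (exp (- (x / 2) * t) * (t * (t * q t)))" for t
    proof (cases "t < 0")
      case True
      then show ?thesis using w by (simp add: laplace_weight_def)
    next
      case False
      have "exp (- (x + h) * t) * q t - exp (- x * t) * q t + h * (exp (- x * t) * (t * q t))
          = exp (- x * t) * q t * (exp (- h * t) - 1 - (- h * t))"
      proof -
        have "exp (- (x + h) * t) = exp (- x * t) * exp (- h * t)"
          by (simp add: exp_add[symmetric] algebra_simps)
        then show ?thesis by (simp only:) (simp add: algebra_simps)
      qed
      then have "norm (exp (- (x + h) * t) * q t - exp (- x * t) * q t + h * (exp (- x * t) * (t * q t)))
          = exp (- x * t) * q t * \<bar>exp (- h * t) - 1 - (- h * t)\<bar>"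
        using q0[of t] by (simp only: real_norm_def abs_mult abs_exp_cancel abs_of_nonneg)
      also have "\<dots> \<le> exp (- x * t) * q t * ((- h * t)\<^sup>2 * exp \<bar>- h * t\<bar>)"
        by (intro mult_left_mono exp_minus_linear_bound mult_nonneg_nonneg q0) simp
      also have "\<dots> \<le> exp (- x * t) * q t * ((- h * t)\<^sup>2 * exp (x / 2 * t))"
      proof -
        have "\<bar>h\<bar> * t \<le> x / 2 * t" using h False by (intro mult_right_mono) auto
        then have "\<bar>- h * t\<bar> \<le> x / 2 * t" using False by (simp add: abs_mult)
        then show ?thesis by (intro mult_left_mono mult_nonneg_nonneg q0) auto
      qed
      also have "\<dots> = h\<^sup>2 * ((exp (- x * t) * exp (x / 2 * t)) * (t * (t * q t)))"
        by (simp add: power2_eq_square mult_ac)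
      also have "exp (- x * t) * exp (x / 2 * t) = exp (- (x / 2) * t)"
        unfolding exp_add[symmetric] by (simp add: field_simps)
      finally show ?thesis .
    qed
    have "(?G (x + h) - ?G x) / h - ?D = (?G (x + h) - ?G x + h * (LINT t|lborel. exp (- x * t) * (t * q t))) / h"
      using h by (simp add: add_divide_distrib)
    also have "?G (x + h) - ?G x + h * (LINT t|lborel. exp (- x * t) * (t * q t)) =
       (LINT t|lborel. exp (- (x + h) * t) * q t - exp (- x * t) * q t + h * (exp (- x * t) * (t * q t)))"
      using int(1)[OF xh] int(1,2)[OF x]
      by (simp only: Bochner_Integration.integral_add Bochner_Integration.integral_diff
          Bochner_Integration.integrable_diff integrable_mult_right integral_mult_right_zero)
    finally have eq: "(?G (x + h) - ?G x) / h - ?D = (LINT t|lborel. exp (- (x + h) * t) * q t - exp (- x * t) * q t + h * (exp (- x * t) * (t * q t))) / h" .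
    have "norm (LINT t|lborel. exp (- (x + h) * t) * q t - exp (- x * t) * q t + h * (exp (- x * t) * (t * q t)))
        \<le> (LINT t|lborel. h\<^sup>2 * (exp (- (x / 2) * t) * (t * (t * q t))))"
    proof (rule Bochner_Integration.integral_norm_bound_integral)
      show "integrable lborel (\<lambda>t. exp (- (x + h) * t) * q t - exp (- x * t) * q t + h * (exp (- x * t) * (t * q t)))"
        by (intro Bochner_Integration.integrable_add Bochner_Integration.integrable_diff
          integrable_mult_right int x xh)
      show "integrable lborel (\<lambda>t. h\<^sup>2 * (exp (- (x / 2) * t) * (t * (t * q t))))"
        using x by (intro integrable_mult_right int) simp
      show "norm (exp (- (x + h) * t) * q t - exp (- x * t) * q t + h * (exp (- x * t) * (t * q t)))
        \<le> h\<^sup>2 * (exp (- (x / 2) * t) * (t * (t * q t)))" for t by (rule pt)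
    qed
    also have "\<dots> = h\<^sup>2 * C" unfolding C_def by (rule integral_mult_right_zero)
    also have "h\<^sup>2 * C = (\<bar>h\<bar> * C) * \<bar>h\<bar>" by (simp add: power2_eq_square)
    finally show ?thesis unfolding eq abs_divide real_norm_def using h
      by (simp only: pos_divide_le_eq zero_less_abs_iff simp_thms)
  qed
  have "((\<lambda>h. (?G (x + h) - ?G x) / h - ?D) \<longlongrightarrow> 0) (at 0)"
  proof (rule Lim_null_comparison)
    have "eventually (\<lambda>h. h \<in> {- (x/2)<..<x/2} - {0}) (at 0)"
      unfolding eventually_at_topological
      using x by (intro exI[of _ "{- (x/2)<..<x/2}"]) auto
    then show "eventually (\<lambda>h. norm ((?G (x + h) - ?G x) / h - ?D) \<le> \<bar>h\<bar> * C) (at 0)"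
      by (rule eventually_mono) (use bound in auto)
    show "((\<lambda>h. \<bar>h\<bar> * C) \<longlongrightarrow> 0) (at 0)"
      by (rule tendsto_eq_intros refl)+ simp
  qed
  then show ?thesis unfolding DERIV_def by (rule Lim_null[THEN iffD2])
qed

text \<open>The easy half of Bernstein's theorem: each derivative brings down a factor
  \<open>-t\<close>. As \<open>g\<close> is prescribed only for \<open>x > 0\<close>, iterated
  derivatives are compared on the open half-line.\<close>

lemma completely_monotonic_laplace:
  assumes w: "laplace_weight q"
    and g: "\<And>x. x > 0 \<Longrightarrow> g x = (LINT t|lborel. exp (- x * t) * q t)"
  shows "completely_monotonic g"
proof -
  note wm = laplace_weight_power[OF w]
  let ?I = "\<lambda>m x. (- 1) ^ m * (LINT t|lborel. exp (- x * t) * (t ^ m * q t))"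
  have DI: "(?I m has_real_derivative ?I (Suc m) x) (at x)" if "x > 0" for m x
    using DERIV_cmult[OF laplace_weight_has_derivative[OF wm[of m] that], of "(- 1) ^ m"]
    by (simp add: mult.assoc)
  have ev: "eventually (\<lambda>x. x \<in> {0<..}) (nhds x)" if "x > 0" for x :: real
    using that by (intro eventually_nhds_in_open) auto
  have eq: "(deriv ^^ m) g x = ?I m x" if "x > 0" for m x
    using that
  proof (induction m arbitrary: x)
    case 0
    then show ?case using g by simp
  next
    case (Suc m)
    have "(deriv ^^ Suc m) g x = deriv ((deriv ^^ m) g) x" by simp
    also have "\<dots> = deriv (?I m) x"
      using ev[OF Suc.prems] by (intro deriv_cong_ev refl) (elim eventually_mono, use Suc.IH in auto)
    also have "\<dots> = ?I (Suc m) x" using DI[OF Suc.prems] by (rule DERIV_imp_deriv)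
    finally show ?case .
  qed
  have "((deriv ^^ m) g has_real_derivative ?I (Suc m) x) (at x)" if "x > 0" for m x
  proof (rule has_field_derivative_transform_within_open[OF DI[OF that]])
    show "open {0::real<..}" by simp
  qed (use that eq in auto)
  moreover have "0 \<le> (- 1) ^ m * (deriv ^^ m) g x" if "x > 0" for m x
  proof -
    have "0 \<le> (LINT t|lborel. exp (- x * t) * (t ^ m * q t))"
      by (intro integral_nonneg_AE AE_I2) (use wm[of m] in \<open>auto simp: laplace_weight_def\<close>)
    moreover have "(- 1) ^ m * (deriv ^^ m) g x = (LINT t|lborel. exp (- x * t) * (t ^ m * q t))"
      unfolding eq[OF that] by (simp add: mult.assoc[symmetric] power_mult_distrib[symmetric])
    ultimately show ?thesis by simp
  qed
  ultimately show ?thesis unfolding completely_monotonic_def field_differentiable_def by blast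
qed


section \<open>Laplace transforms in the extended nonnegative reals and multiplication by powers of
  x\<close>

definition laplace_nn :: "(real \<Rightarrow> real) \<Rightarrow> real \<Rightarrow> ennreal" where
  "laplace_nn f x = (\<integral>\<^sup>+t. ennreal (exp (- x * t) * f t) * indicator {0..} t \<partial>lborel)"

lemma nn_integral_exp_tail:
  assumes "x > 0"
  shows "(\<integral>\<^sup>+s. ennreal (x * exp (- x * s)) * indicator {t..} s \<partial>lborel) = ennreal (exp (- x * t))"
proof -
  have "((\<lambda>s. exp (- x * s)) \<longlongrightarrow> 0) at_top"
    using filterlim_tendsto_pos_mult_at_top[OF tendsto_const assms filterlim_ident]
    by (intro filterlim_compose[OF exp_at_bot]) (simp add: filterlim_uminus_at_bot)
  then have "((\<lambda>s. - exp (- x * s)) \<longlongrightarrow> 0) at_top"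
    using tendsto_minus by fastforce
  then have "(\<integral>\<^sup>+s. ennreal (x * exp (- x * s)) * indicator {t..} s \<partial>lborel) = ennreal (0 - (- exp (- x * t)))"
    by (intro nn_integral_FTC_atLeast) (use assms in \<open>auto intro!: derivative_eq_intros\<close>)
  then show ?thesis by simp
qed

text \<open>Integration by parts in the guise of Tonelli: write \<open>exp (- x t)\<close> as the
  integral of \<open>x exp (- x s)\<close> over \<open>s >= t\<close> and swap; the inner integral
  of \<open>f'\<close> over \<open>[0, s]\<close> is then \<open>f s\<close>. In this form no
  boundary term at infinity arises.\<close>

lemma laplace_nn_derivative:
  assumes "f 0 = 0" and f': "\<And>t. t \<ge> 0 \<Longrightarrow> (f has_real_derivative f' t) (at t within {0..})"
    and cont: "continuous_on {0..} f'" and nonneg: "\<And>t. t \<ge> 0 \<Longrightarrow> 0 \<le> f' t" and x: "x > 0"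
  shows "laplace_nn f' x = ennreal x * laplace_nn f x"
proof -
  \<comment> \<open>\<open>f'\<close> is continuous only on the half-line; its cut-off is Borel on
    the whole line.\<close>
  define g where "g t = indicator {0..} t * f' t" for t
  have g [measurable]: "g \<in> borel_measurable borel"
    unfolding g_def using borel_measurable_continuous_on_indicator[OF _ cont] by simp
  have head: "(\<integral>\<^sup>+t. ennreal (g t) * indicator {..s} t \<partial>lborel) = ennreal (f s)" if "s \<ge> 0" for s
  proof -
    have "(f' has_integral (f s - f 0)) {0..s}"
    proof (rule fundamental_theorem_of_calculus[OF that])
      show "(f has_vector_derivative f' t) (at t within {0..s})" if "t \<in> {0..s}" for t
        using f'[of t] that
        by (auto simp flip: has_real_derivative_iff_has_vector_derivative intro: DERIV_subset)
    qed
    then have "(\<integral>\<^sup>+t. ennreal (indicator {0..s} t * f' t) \<partial>lborel) = ennreal (f s)"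
      using nn_integral_has_integral_lebesgue[of "{0..s}" f'] nonneg assms(1) by simp
    moreover have "ennreal (g t) * indicator {..s} t = ennreal (indicator {0..s} t * f' t)" for t
      by (auto simp: g_def indicator_def)
    ultimately show ?thesis by simp
  qed
  let ?F = "\<lambda>t s. ennreal (g t) * (ennreal (x * exp (- x * s)) * indicator {t..} s)"
  have "laplace_nn f' x = (\<integral>\<^sup>+t. (\<integral>\<^sup>+s. ?F t s \<partial>lborel) \<partial>lborel)"
    unfolding laplace_nn_def
  proof (rule nn_integral_cong)
    fix t
    have "(\<integral>\<^sup>+s. ?F t s \<partial>lborel) = ennreal (g t) * ennreal (exp (- x * t))"
      unfolding nn_integral_exp_tail[OF x, symmetric] by (intro nn_integral_cmult) measurable
    then show "ennreal (exp (- x * t) * f' t) * indicator {0..} t = (\<integral>\<^sup>+s. ?F t s \<partial>lborel)"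
      by (auto simp: g_def indicator_def ennreal_mult' nonneg mult.commute)
  qed
  also have "\<dots> = (\<integral>\<^sup>+s. (\<integral>\<^sup>+t. ?F t s \<partial>lborel) \<partial>lborel)"
  proof (rule lborel_pair.Fubini'[symmetric])
    \<comment> \<open>The set \<open>{t..}\<close> varies with \<open>t\<close>; written as the
      condition \<open>t <= s\<close>, its indicator is seen to be jointly measurable.\<close>
    have "(\<lambda>(t, s). ennreal (g t) * (ennreal (x * exp (- x * s)) * (if t \<le> s then 1 else 0)))
        \<in> borel_measurable (lborel \<Otimes>\<^sub>M lborel)" by measurable
    moreover have "(\<lambda>(t, s). ?F t s) = (\<lambda>(t, s). ennreal (g t) * (ennreal (x * exp (- x * s)) * (if t \<le> s then 1 else 0)))"
      by (auto simp: fun_eq_iff indicator_def)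
    ultimately show "(\<lambda>(t, s). ?F t s) \<in> borel_measurable (lborel \<Otimes>\<^sub>M lborel)" by (simp only:)
  qed
  also have "\<dots> = (\<integral>\<^sup>+s. ennreal x * (ennreal (exp (- x * s) * f s) * indicator {0..} s) \<partial>lborel)"
  proof (rule nn_integral_cong)
    fix s
    have "(\<integral>\<^sup>+t. ?F t s \<partial>lborel) = (\<integral>\<^sup>+t. ennreal (x * exp (- x * s)) * (ennreal (g t) * indicator {..s} t) \<partial>lborel)"
      by (intro nn_integral_cong) (auto simp: indicator_def mult.commute)
    also have "\<dots> = ennreal (x * exp (- x * s)) * (\<integral>\<^sup>+t. ennreal (g t) * indicator {..s} t \<partial>lborel)"
      by (intro nn_integral_cmult) measurable
    also have "\<dots> = ennreal x * (ennreal (exp (- x * s) * f s) * indicator {0..} s)"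
    proof (cases "s \<ge> 0")
      case True
      then show ?thesis using x unfolding head[OF True] by (simp add: ennreal_mult' mult.assoc)
    next
      case False
      then have "(\<lambda>t. ennreal (g t) * indicator {..s} t) = (\<lambda>_. 0)"
        by (auto simp: g_def indicator_def fun_eq_iff)
      then show ?thesis using False by (simp only:) simp
    qed
    finally show "(\<integral>\<^sup>+t. ?F t s \<partial>lborel) = ennreal x * (ennreal (exp (- x * s) * f s) * indicator {0..} s)" .
  qed
  also have "\<dots> = ennreal x * laplace_nn f x"
  proof -
    have cf: "continuous_on {0..} f"
      by (rule DERIV_continuous_on[of _ _ f']) (use f' in auto)
    have [measurable]: "(\<lambda>s. indicator {0..} s * f s) \<in> borel_measurable borel"
      using borel_measurable_continuous_on_indicator[OF _ cf] by simp
    have "(\<lambda>s. ennreal (exp (- x * s) * f s) * indicator {0..} s) = (\<lambda>s. ennreal (exp (- x * s) * (indicator {0..} s * f s)))"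
      by (auto simp: fun_eq_iff indicator_def)
    then have "(\<lambda>s. ennreal (exp (- x * s) * f s) * indicator {0..} s) \<in> borel_measurable lborel"
      by simp
    then show ?thesis unfolding laplace_nn_def by (rule nn_integral_cmult)
  qed
  finally show ?thesis .
qed

lemma repeated_nonneg_integral_continuous:
  assumes "repeated_nonneg_integral k f"
  shows "continuous_on {0..} f" "\<And>t. t \<ge> 0 \<Longrightarrow> 0 \<le> f t"
  using repeated_nonneg_integral_mono[OF assms le0] by (auto elim: repeated_nonneg_integral_zeroE)

text \<open>\<open>q\<close> is the \<open>k\<close>-th derivative of \<open>f\<close>, cut off to
  the half-line; each differentiation contributes one factor \<open>x\<close>.\<close>

lemma laplace_nn_repeated:
  assumes "repeated_nonneg_integral k f"
  shows "\<exists>q. q \<in> borel_measurable borel \<and> (\<forall>t. 0 \<le> q t) \<and>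
    (\<forall>x>0. laplace_nn q x = ennreal (x ^ k) * laplace_nn f x)"
  using assms
proof induction
  case (zero f)
  define q where "q t = indicator {0..} t * f t" for t
  have "q \<in> borel_measurable borel"
    unfolding q_def using borel_measurable_continuous_on_indicator[OF _ zero(1)] by simp
  moreover have "laplace_nn q x = laplace_nn f x" for x
    unfolding laplace_nn_def q_def by (intro nn_integral_cong) (auto simp: indicator_def)
  moreover have "0 \<le> q t" for t using zero(2) by (simp add: q_def indicator_def)
  ultimately show ?case by (intro exI[of _ q]) simp
next
  case (Suc f f' k)
  then obtain q where q: "q \<in> borel_measurable borel" "\<And>t. 0 \<le> q t"
    "\<And>x. x > 0 \<Longrightarrow> laplace_nn q x = ennreal (x ^ k) * laplace_nn f' x" by blast
  have "laplace_nn q x = ennreal (x ^ Suc k) * laplace_nn f x" if "x > 0" for x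
    using laplace_nn_derivative[OF Suc.hyps(1,2) repeated_nonneg_integral_continuous[OF Suc.hyps(3)] that] that
    unfolding q(3)[OF that] by (simp add: ennreal_mult' mult_ac)
  then show ?case using q(1,2) by blast
qed

lemma laplace_nn_suminf:
  assumes "\<And>j. f j \<in> borel_measurable borel" "\<And>j t. t \<ge> 0 \<Longrightarrow> 0 \<le> f j t"
    "\<And>t. t > 0 \<Longrightarrow> (\<lambda>j. f j t) sums g t"
  shows "laplace_nn g x = (\<Sum>j. laplace_nn (f j) x)"
proof -
  have [measurable]: "f j \<in> borel_measurable borel" for j by fact
  have "laplace_nn g x = (\<integral>\<^sup>+t. (\<Sum>j. ennreal (exp (- x * t) * f j t) * indicator {0..} t) \<partial>lborel)"
    unfolding laplace_nn_def
  proof (rule nn_integral_cong_AE)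
    have eq: "ennreal (exp (- x * t) * g t) = (\<Sum>j. ennreal (exp (- x * t) * f j t))" if "t > 0" for t
      using sums_mult[OF assms(3)[OF that], of "exp (- x * t)"] assms(2)[of t] that
      by (subst suminf_ennreal2) (auto simp: sums_iff)
    \<comment> \<open>Convergence to \<open>g\<close> is known only for \<open>t > 0\<close>; the
      single point 0 is negligible.\<close>
    have "AE t in lborel. t \<noteq> (0::real)" by (rule AE_lborel_singleton)
    then show "AE t in lborel. ennreal (exp (- x * t) * g t) * indicator {0..} t =
        (\<Sum>j. ennreal (exp (- x * t) * f j t) * indicator {0..} t)"
      by eventually_elim (use eq in \<open>auto simp: indicator_def\<close>)
  qed
  also have "\<dots> = (\<Sum>j. laplace_nn (f j) x)"
    unfolding laplace_nn_def by (intro nn_integral_suminf) measurable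
  finally show ?thesis .
qed

text \<open>The series of the \<open>p j\<close> is never differentiated termwise. Instead the
  nonnegative \<open>k\<close>-th derivatives \<open>q j\<close> are summed in
  \<open>ennreal\<close>, and monotone convergence shows that their sum has \<open>x ^ k\<close>
  times the Laplace transform of \<open>P\<close>.\<close>

theorem completely_monotonic_laplace_series:
  assumes p: "\<And>j. repeated_nonneg_integral k (p j)"
    and pm [measurable]: "\<And>j. p j \<in> borel_measurable borel"
    and P: "\<And>t. t > 0 \<Longrightarrow> (\<lambda>j. p j t) sums P t"
    and fin: "\<And>x. x > 0 \<Longrightarrow> laplace_nn P x < \<infinity>"
    and g: "\<And>x. x > 0 \<Longrightarrow> g x = x ^ k * enn2real (laplace_nn P x)"
  shows "completely_monotonic g"
proof -
  have "\<exists>q. q \<in> borel_measurable borel \<and> (\<forall>t. 0 \<le> q t) \<and>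
      (\<forall>x>0. laplace_nn q x = ennreal (x ^ k) * laplace_nn (p j) x)" for j
    by (rule laplace_nn_repeated[OF p])
  then obtain q where qm [measurable]: "\<And>j. q j \<in> borel_measurable borel"
    and q0: "\<And>j t. 0 \<le> q j t"
    and q: "\<And>j x. x > 0 \<Longrightarrow> laplace_nn (q j) x = ennreal (x ^ k) * laplace_nn (p j) x" by metis
  define Q where "Q t = (\<Sum>j. ennreal (q j t)) * indicator {0..} t" for t
  have [measurable]: "Q \<in> borel_measurable borel" unfolding Q_def by measurable
  have Q: "(\<integral>\<^sup>+t. ennreal (exp (- x * t)) * Q t \<partial>lborel) = ennreal (x ^ k) * laplace_nn P x" if "x > 0" for x
  proof -
    have "(\<integral>\<^sup>+t. ennreal (exp (- x * t)) * Q t \<partial>lborel) =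
        (\<integral>\<^sup>+t. (\<Sum>j. ennreal (exp (- x * t) * q j t) * indicator {0..} t) \<partial>lborel)"
    proof (rule nn_integral_cong)
      fix t
      have "ennreal (exp (- x * t)) * Q t = (\<Sum>j. ennreal (exp (- x * t)) * ennreal (q j t)) * indicator {0..} t"
        unfolding Q_def by (simp only: ennreal_suminf_cmult mult.assoc)
      then show "ennreal (exp (- x * t)) * Q t = (\<Sum>j. ennreal (exp (- x * t) * q j t) * indicator {0..} t)"
        by (simp only: ennreal_suminf_multc ennreal_mult'[OF exp_ge_zero])
    qed
    also have "\<dots> = (\<Sum>j. laplace_nn (q j) x)"
      unfolding laplace_nn_def by (intro nn_integral_suminf) measurable
    also have "\<dots> = ennreal (x ^ k) * (\<Sum>j. laplace_nn (p j) x)"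
      using that by (simp add: q)
    also have "(\<Sum>j. laplace_nn (p j) x) = laplace_nn P x"
      using repeated_nonneg_integral_continuous(2)[OF p] P by (intro laplace_nn_suminf[symmetric] pm) auto
    finally show ?thesis .
  qed
  have Qfin: "(\<integral>\<^sup>+t. ennreal (exp (- x * t)) * Q t \<partial>lborel) < \<infinity>" if "x > 0" for x
    unfolding Q[OF that] using fin[OF that] by (simp add: ennreal_mult_less_top)
  \<comment> \<open>Finiteness of the integral at \<open>x = 1\<close> already forces
    \<open>Q\<close> to be finite almost everywhere, so \<open>enn2real\<close> changes it only on a
    null set.\<close>
  have "AE t in lborel. ennreal (exp (- 1 * t)) * Q t \<noteq> \<infinity>"
    using Qfin[of 1] by (intro nn_integral_PInf_AE) auto
  then have AEQ: "AE t in lborel. Q t \<noteq> \<infinity>"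
    by eventually_elim (auto simp: ennreal_mult_eq_top_iff)
  define r where "r t = enn2real (Q t)" for t
  have [measurable]: "r \<in> borel_measurable borel" unfolding r_def by measurable
  have rQ: "(\<integral>\<^sup>+t. ennreal (exp (- x * t) * r t) \<partial>lborel) = (\<integral>\<^sup>+t. ennreal (exp (- x * t)) * Q t \<partial>lborel)" for x
  proof (rule nn_integral_cong_AE)
    show "AE t in lborel. ennreal (exp (- x * t) * r t) = ennreal (exp (- x * t)) * Q t"
      using AEQ by eventually_elim (simp add: r_def ennreal_mult' less_top)
  qed
  have r0: "0 \<le> r t" for t unfolding r_def by simp
  have w: "laplace_weight r"
    unfolding laplace_weight_def
  proof (intro conjI allI impI)
    show "r t = 0" if "t < 0" for t using that by (simp add: r_def Q_def)
    show "integrable lborel (\<lambda>t. exp (- x * t) * r t)" if "x > 0" for x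
      by (rule integrableI_nonneg) (use Qfin[OF that] rQ[of x] r0 in auto)
  qed (auto simp: r0)
  have "g x = (LINT t|lborel. exp (- x * t) * r t)" if "x > 0" for x
  proof -
    have "(LINT t|lborel. exp (- x * t) * r t) = enn2real (\<integral>\<^sup>+t. ennreal (exp (- x * t) * r t) \<partial>lborel)"
      by (rule integral_eq_nn_integral) (auto simp: r0)
    then show ?thesis unfolding rQ Q[OF that] g[OF that] using that by (simp add: enn2real_mult)
  qed
  with w show ?thesis by (rule completely_monotonic_laplace)
qed


section \<open>Partial fractions\<close>

text \<open>The nonzero poles of \<open>1 / (1 - exp (- t))\<close> are plus and minus
  \<open>i * pole j\<close>; the shift by 1 lets \<open>j\<close> run over all natural
  numbers.\<close>

definition pole :: "nat \<Rightarrow> real" where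
  "pole j = 2 * pi * (real j + 1)"

lemma pole_pos: "pole j > 0"
  by (simp add: pole_def)

lemma pole_nonzero [simp]: "pole j \<noteq> 0"
  using pole_pos[of j] by simp

lemma summable_inverse_pole_power:
  assumes "i \<ge> 2"
  shows "summable (\<lambda>j. 1 / pole j ^ i)"
proof -
  have "summable (\<lambda>n. inverse (real n ^ i))"
    using inverse_power_summable[OF assms, where 'a = real] by simp
  then have "summable (\<lambda>j. inverse (real (Suc j) ^ i))"
    by (subst summable_Suc_iff)
  then have "summable (\<lambda>j. (1 / (2 * pi) ^ i) * inverse (real (Suc j) ^ i))"
    by (rule summable_mult)
  then show ?thesis
    by (rule summable_cong[THEN iffD1, rotated])
      (simp add: pole_def power_mult_distrib divide_inverse add.commute)
qed

text \<open>Euler's product for \<open>sin (pi z)\<close> at \<open>z = i t / (2 pi)\<close>, where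
  \<open>sin (pi z) = i sinh (t / 2)\<close>.\<close>

lemma sinh_product:
  assumes "t \<noteq> 0"
  shows "(\<lambda>n. \<Prod>j<n. 1 + t\<^sup>2 / pole j ^ 2) \<longlonglongrightarrow> sinh (t / 2) / (t / 2)"
proof -
  define z where "z = \<i> * complex_of_real (t / (2 * pi))"
  have P: "(\<Prod>k=1..n. 1 - z\<^sup>2 / of_nat k ^ 2) = complex_of_real (\<Prod>j<n. 1 + t\<^sup>2 / pole j ^ 2)" for n
  proof -
    have "(\<Prod>k=1..n. 1 - z\<^sup>2 / of_nat k ^ 2) = (\<Prod>j<n. 1 - z\<^sup>2 / of_nat (Suc j) ^ 2)"
      using prod.atLeast1_atMost_eq[of "\<lambda>k. 1 - z\<^sup>2 / of_nat k ^ 2" n] by simp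
    also have "\<dots> = (\<Prod>j<n. complex_of_real (1 + t\<^sup>2 / pole j ^ 2))"
    proof (rule prod.cong[OF refl])
      fix j
      have "1 - z\<^sup>2 / of_nat (Suc j) ^ 2 = complex_of_real (1 + (t / (2 * pi))\<^sup>2 / real (Suc j) ^ 2)"
        by (simp add: z_def power_mult_distrib power_divide)
      also have "(t / (2 * pi))\<^sup>2 / real (Suc j) ^ 2 = t\<^sup>2 / pole j ^ 2"
        by (simp add: pole_def power_mult_distrib power_divide add.commute)
      finally show "1 - z\<^sup>2 / of_nat (Suc j) ^ 2 = complex_of_real (1 + t\<^sup>2 / pole j ^ 2)" .
    qed
    finally show ?thesis by simp
  qed
  have z: "of_real pi * z = \<i> * complex_of_real (t / 2)" by (simp add: z_def)
  have s: "sin (\<i> * complex_of_real (t / 2)) = \<i> * of_real (sinh (t / 2))"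
  proof -
    have "\<i> * sinh (complex_of_real (t / 2)) = sin (\<i> * complex_of_real (t / 2))"
      unfolding sinh_conv_sin by simp
    moreover have "sinh (complex_of_real (t / 2)) = of_real (sinh (t / 2))"
      by (simp add: sinh_field_def exp_of_real[symmetric])
    ultimately show ?thesis by (simp only:)
  qed
  have "(\<lambda>n. \<i> * complex_of_real (t / 2) * complex_of_real (\<Prod>j<n. 1 + t\<^sup>2 / pole j ^ 2))
      \<longlonglongrightarrow> \<i> * of_real (sinh (t / 2))"
    using sin_product_formula_complex[of z] unfolding P z s .
  then have "(\<lambda>n. (- \<i>) * (\<i> * complex_of_real (t / 2) * complex_of_real (\<Prod>j<n. 1 + t\<^sup>2 / pole j ^ 2)))
      \<longlonglongrightarrow> (- \<i>) * (\<i> * of_real (sinh (t / 2)))" by (rule tendsto_mult_left)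
  moreover have "(- \<i>) * (\<i> * complex_of_real a * complex_of_real b) = complex_of_real (a * b)"
      "(- \<i>) * (\<i> * complex_of_real a) = complex_of_real a" for a b
    by (simp_all add: complex_eq_iff)
  ultimately have "(\<lambda>n. complex_of_real (t / 2 * (\<Prod>j<n. 1 + t\<^sup>2 / pole j ^ 2)))
      \<longlonglongrightarrow> complex_of_real (sinh (t / 2))" by (simp only:)
  then have "(\<lambda>n. t / 2 * (\<Prod>j<n. 1 + t\<^sup>2 / pole j ^ 2)) \<longlonglongrightarrow> sinh (t / 2)"
    unfolding tendsto_of_real_iff .
  then have "(\<lambda>n. (t / 2 * (\<Prod>j<n. 1 + t\<^sup>2 / pole j ^ 2)) / (t / 2)) \<longlonglongrightarrow> sinh (t / 2) / (t / 2)"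
    using assms by (intro tendsto_divide tendsto_const) auto
  then show ?thesis using assms by simp
qed

text \<open>The right-hand side is \<open>ln (sinh (t/2) / (t/2))\<close>.\<close>

lemma ln_sinh_series:
  assumes "t > 0"
  shows "(\<lambda>j. ln (1 + t\<^sup>2 / pole j ^ 2)) sums (t / 2 + ln (1 - exp (- t)) - ln t)"
proof -
  have pos: "1 + t\<^sup>2 / pole j ^ 2 > 0" for j by (simp add: add_pos_nonneg)
  have "(\<lambda>n. ln (\<Prod>j<n. 1 + t\<^sup>2 / pole j ^ 2)) \<longlonglongrightarrow> ln (sinh (t / 2) / (t / 2))"
    using assms by (intro tendsto_ln sinh_product) auto
  moreover have "ln (\<Prod>j<n. 1 + t\<^sup>2 / pole j ^ 2) = (\<Sum>j<n. ln (1 + t\<^sup>2 / pole j ^ 2))" for n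
    using pos by (intro ln_prod) (auto simp: less_imp_neq[symmetric])
  moreover have "ln (sinh (t / 2) / (t / 2)) = t / 2 + ln (1 - exp (- t)) - ln t"
  proof -
    have "sinh (t / 2) / (t / 2) = exp (t / 2) * (1 - exp (- t)) / t"
    proof -
      have "exp (t / 2) * exp (- t) = exp (- (t / 2))" by (simp flip: exp_add)
      then show ?thesis by (simp add: sinh_def algebra_simps)
    qed
    also have "ln \<dots> = t / 2 + ln (1 - exp (- t)) - ln t"
      using assms by (simp add: ln_div ln_mult)
    finally show ?thesis .
  qed
  ultimately show ?thesis unfolding sums_def by (simp only:)
qed

lemma square_plus_pole_pos: "x\<^sup>2 + pole j ^ 2 > 0"
  by (simp add: add_nonneg_pos)

lemma inverse_square_plus_pole_le: "1 / (x\<^sup>2 + pole j ^ 2) \<le> 1 / pole j ^ 2"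
  by (rule divide_left_mono) (use square_plus_pole_pos[of x j] in \<open>auto intro!: mult_pos_pos\<close>)

text \<open>Termwise derivative of \<open>ln_sinh_series\<close>: the majorant
  \<open>2 (t + 1) / pole j ^ 2\<close> gives uniform convergence of the derivatives on
  \<open>[0, t + 1]\<close>, which has \<open>t\<close> in its interior.\<close>

lemma partial_fraction_1:
  assumes t: "t > 0"
  shows "(\<lambda>j. 2 * t / (t\<^sup>2 + pole j ^ 2)) sums (1 / (1 - exp (- t)) - 1 / 2 - 1 / t)"
proof -
  let ?S = "{0..t + 1}"
  let ?f = "\<lambda>j x. ln (1 + x\<^sup>2 / pole j ^ 2)" and ?f' = "\<lambda>j x. 2 * x / (x\<^sup>2 + pole j ^ 2)"
  have bound: "norm (?f' j x) \<le> 2 * (t + 1) * (1 / pole j ^ 2)" if "x \<in> ?S" for j x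
  proof -
    have "2 * x * (1 / (x\<^sup>2 + pole j ^ 2)) \<le> 2 * (t + 1) * (1 / pole j ^ 2)"
      using that t square_plus_pole_pos[of x j]
      by (intro mult_mono inverse_square_plus_pole_le) auto
    then show ?thesis using that square_plus_pole_pos[of x j] by simp
  qed
  have summ: "summable (\<lambda>j. 2 * (t + 1) * (1 / pole j ^ 2))"
    by (intro summable_mult summable_inverse_pole_power) simp
  have "((\<lambda>x. \<Sum>j. ?f j x) has_field_derivative (\<Sum>j. ?f' j t)) (at t)"
  \<comment> \<open>The argument 0 is the point where the undifferentiated series has to converge;
    all its terms vanish there.\<close>
  proof (rule has_field_derivative_series'(2)[of ?S ?f ?f' 0])
    show "(?f j has_field_derivative ?f' j x) (at x within ?S)" for j x
    proof -
      have "1 + x\<^sup>2 / pole j ^ 2 > 0" by (simp add: add_pos_nonneg)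
      moreover have "((\<lambda>x. 1 + x\<^sup>2 / pole j ^ 2) has_field_derivative 2 * x / pole j ^ 2) (at x within ?S)"
        by (auto intro!: derivative_eq_intros simp: power2_eq_square)
      ultimately have "(?f j has_field_derivative
          1 / (1 + x\<^sup>2 / pole j ^ 2) * (2 * x / pole j ^ 2)) (at x within ?S)"
        by (intro DERIV_chain2[OF DERIV_ln_divide])
      moreover have "1 / (1 + x\<^sup>2 / pole j ^ 2) * (2 * x / pole j ^ 2) = ?f' j x"
      proof -
        have "1 + x\<^sup>2 / pole j ^ 2 = (x\<^sup>2 + pole j ^ 2) / pole j ^ 2"
          by (simp add: add_divide_distrib)
        then show ?thesis by simp
      qed
      ultimately show ?thesis by (simp only:)
    qed
    show "uniformly_convergent_on ?S (\<lambda>n x. \<Sum>j<n. ?f' j x)"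
      by (rule Weierstrass_m_test'[OF bound summ])
  qed (use t in \<open>auto simp: interior_atLeastAtMost_real\<close>)
  moreover have "((\<lambda>x. \<Sum>j. ?f j x) has_field_derivative (1 / (1 - exp (- t)) - 1 / 2 - 1 / t)) (at t)"
  proof (rule has_field_derivative_transform_within_open)
    show "((\<lambda>x. x / 2 + ln (1 - exp (- x)) - ln x) has_field_derivative (1 / (1 - exp (- t)) - 1 / 2 - 1 / t)) (at t)"
    proof -
      have "exp (- t) < 1" using t by simp
      then have "((\<lambda>x. x / 2 + ln (1 - exp (- x)) - ln x) has_field_derivative
          (1 / 2 + exp (- t) / (1 - exp (- t)) - 1 / t)) (at t)"
        using t by (auto intro!: derivative_eq_intros)
      moreover have "exp (- t) / (1 - exp (- t)) = 1 / (1 - exp (- t)) - 1"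
        proof -
        have "(1 - u) / u = 1 / u - 1" if "u > 0" for u :: real
          using that by (simp add: diff_divide_distrib)
        from this[of "1 - exp (- t)"] \<open>exp (- t) < 1\<close> show ?thesis by simp
      qed
      ultimately show ?thesis by simp
    qed
    show "open {0::real<..}" by simp
    show "x / 2 + ln (1 - exp (- x)) - ln x = (\<Sum>j. ?f j x)" if "x \<in> {0<..}" for x
      using ln_sinh_series[of x] that by (simp add: sums_iff)
  qed (use t in simp)
  ultimately have "(\<Sum>j. ?f' j t) = 1 / (1 - exp (- t)) - 1 / 2 - 1 / t" by (rule DERIV_unique)
  moreover have "summable (\<lambda>j. ?f' j t)"
    by (rule summable_comparison_test'[OF summ]) (use bound[of t] t in auto)
  ultimately show ?thesis by (simp add: sums_iff)
qed

text \<open>Termwise derivative of \<open>partial_fraction_1\<close>, now with majorant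
  \<open>2 / pole j ^ 2\<close>.\<close>

lemma partial_fraction_2:
  assumes t: "t > 0"
  shows "(\<lambda>j. 2 * (pole j ^ 2 - t\<^sup>2) / (t\<^sup>2 + pole j ^ 2)\<^sup>2) sums
    (1 / t\<^sup>2 - exp (- t) / (1 - exp (- t))\<^sup>2)"
proof -
  let ?S = "{0..t + 1}"
  let ?f = "\<lambda>j x. 2 * x / (x\<^sup>2 + pole j ^ 2)"
    and ?f' = "\<lambda>j x. 2 * (pole j ^ 2 - x\<^sup>2) / (x\<^sup>2 + pole j ^ 2)\<^sup>2"
  have bound: "norm (?f' j x) \<le> 2 * (1 / pole j ^ 2)" for j x
  proof -
    have "norm (?f' j x) \<le> 2 * (x\<^sup>2 + pole j ^ 2) / (x\<^sup>2 + pole j ^ 2)\<^sup>2"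
      by (simp add: abs_mult divide_right_mono abs_le_iff)
    also have "\<dots> = 2 * (1 / (x\<^sup>2 + pole j ^ 2))"
    proof -
      have "2 * A / A\<^sup>2 = 2 * (1 / A)" if "A > 0" for A :: real
        using that by (simp add: power2_eq_square)
      then show ?thesis using square_plus_pole_pos[of x j] by blast
    qed
    also have "\<dots> \<le> 2 * (1 / pole j ^ 2)"
      by (intro mult_left_mono inverse_square_plus_pole_le) simp
    finally show ?thesis .
  qed
  have summ: "summable (\<lambda>j. 2 * (1 / pole j ^ 2))"
    by (intro summable_mult summable_inverse_pole_power) simp
  have "((\<lambda>x. \<Sum>j. ?f j x) has_field_derivative (\<Sum>j. ?f' j t)) (at t)"
  proof (rule has_field_derivative_series'(2)[of ?S ?f ?f' 0])
    show "(?f j has_field_derivative ?f' j x) (at x within ?S)" for j x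
      using square_plus_pole_pos[of x j]
      by (auto intro!: derivative_eq_intros simp: power2_eq_square algebra_simps)
    show "uniformly_convergent_on ?S (\<lambda>n x. \<Sum>j<n. ?f' j x)"
      by (rule Weierstrass_m_test'[OF bound summ])
  qed (use t in \<open>auto simp: interior_atLeastAtMost_real\<close>)
  moreover have "((\<lambda>x. \<Sum>j. ?f j x) has_field_derivative (1 / t\<^sup>2 - exp (- t) / (1 - exp (- t))\<^sup>2)) (at t)"
  proof (rule has_field_derivative_transform_within_open)
    have "exp (- t) \<noteq> 1" using t by simp
    then show "((\<lambda>x. 1 / (1 - exp (- x)) - 1 / 2 - 1 / x) has_field_derivative
        (1 / t\<^sup>2 - exp (- t) / (1 - exp (- t))\<^sup>2)) (at t)"
      using t by (auto intro!: derivative_eq_intros simp: power2_eq_square)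
    show "open {0::real<..}" by simp
    show "1 / (1 - exp (- x)) - 1 / 2 - 1 / x = (\<Sum>j. ?f j x)" if "x \<in> {0<..}" for x
      using partial_fraction_1[of x] that by (simp add: sums_iff)
  qed (use t in simp)
  ultimately have "(\<Sum>j. ?f' j t) = 1 / t\<^sup>2 - exp (- t) / (1 - exp (- t))\<^sup>2" by (rule DERIV_unique)
  moreover have "summable (\<lambda>j. ?f' j t)"
    by (rule summable_comparison_test'[OF summ]) (use bound[of _ t] in auto)
  ultimately show ?thesis by (simp add: sums_iff)
qed


section \<open>Expansion of the remainder integrand\<close>

text \<open>For \<open>i >= 2\<close> this is \<open>zeta(i) / (2 pi)^i\<close>. No closed form is
  computed: the link with the double Bernoulli numbers comes from uniqueness of Taylor
  polynomials.\<close>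

definition pole_sum :: "nat \<Rightarrow> real" where
  "pole_sum i = (\<Sum>j. 1 / pole j ^ i)"

lemma pole_sum_sums: "i \<ge> 2 \<Longrightarrow> (\<lambda>j. 1 / pole j ^ i) sums pole_sum i"
  unfolding pole_sum_def by (intro summable_sums summable_inverse_pole_power)

text \<open>This is \<open>p_a\<close> of the introduction with \<open>a = pole j\<close>.\<close>

definition remainder_kernel :: "nat \<Rightarrow> nat \<Rightarrow> real \<Rightarrow> real" where
  "remainder_kernel m j t =
     2 / pole j ^ 2 * even_kernel m (t / pole j) + 2 / pole j ^ 3 * odd_kernel m (t / pole j)"

lemma even_kernel_Suc: "even_kernel m s + even_kernel (Suc m) s = s ^ (2 * m)"
proof -
  have "even_kernel m s + even_kernel (Suc m) s = s ^ (2 * m) * (1 + s\<^sup>2) / (1 + s\<^sup>2)"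
    unfolding even_kernel_def by (simp add: add_divide_distrib power2_eq_square algebra_simps)
  then show ?thesis using one_plus_square_pos[of s] by simp
qed

text \<open>Since \<open>odd_kernel m s\<close> is \<open>(1/s) d/ds (s^(2m+3) / (1 + s^2))\<close>,
  the sum is \<open>(1/s) d/ds s^(2m+3)\<close>. The proof checks this algebraically in terms of
  \<open>d = 1 + s^2\<close>.\<close>

lemma odd_kernel_Suc:
  "odd_kernel m s + odd_kernel (Suc m) s = (2 * real m + 3) * s ^ (2 * m + 1)"
proof -
  define d where "d = 1 + s\<^sup>2"
  have d: "d > 0" unfolding d_def by (rule one_plus_square_pos)
  have s2: "s\<^sup>2 = d - 1" by (simp add: d_def)
  have "odd_kernel m s + odd_kernel (Suc m) s =
      s ^ (2 * m + 1) * ((2 * real m / d + (3 + s\<^sup>2) / d\<^sup>2) + s\<^sup>2 * (2 * real (Suc m) / d + (3 + s\<^sup>2) / d\<^sup>2))"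
    unfolding odd_kernel_def d_def[symmetric] by (simp add: power2_eq_square algebra_simps)
  also have "(2 * real m / d + (3 + s\<^sup>2) / d\<^sup>2) + s\<^sup>2 * (2 * real (Suc m) / d + (3 + s\<^sup>2) / d\<^sup>2) = 2 * real m + 3"
  proof -
    have "(2 * real m / d + (3 + s\<^sup>2) / d\<^sup>2) + s\<^sup>2 * (2 * real (Suc m) / d + (3 + s\<^sup>2) / d\<^sup>2) =
       (2 * real m * d + (d + 2) + (d - 1) * (2 * real (Suc m) * d + (d + 2))) / d\<^sup>2"
      unfolding s2 using d by (simp add: field_simps power2_eq_square)
    also have "2 * real m * d + (d + 2) + (d - 1) * (2 * real (Suc m) * d + (d + 2)) = (2 * real m + 3) * d\<^sup>2"
      by (simp add: algebra_simps power2_eq_square)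
    finally show ?thesis using d by simp
  qed
  finally show ?thesis by simp
qed

lemma remainder_kernel_Suc:
  "remainder_kernel m j t + remainder_kernel (Suc m) j t =
     2 * t ^ (2 * m) * (1 / pole j ^ (2 * m + 2)) +
     2 * (2 * real m + 3) * t ^ (2 * m + 1) * (1 / pole j ^ (2 * m + 4))"
proof -
  have "remainder_kernel m j t + remainder_kernel (Suc m) j t =
      2 / pole j ^ 2 * (even_kernel m (t / pole j) + even_kernel (Suc m) (t / pole j)) +
      2 / pole j ^ 3 * (odd_kernel m (t / pole j) + odd_kernel (Suc m) (t / pole j))"
    unfolding remainder_kernel_def by (simp add: distrib_left)
  also have "\<dots> = 2 / pole j ^ 2 * (t / pole j) ^ (2 * m) +
      2 / pole j ^ 3 * ((2 * real m + 3) * (t / pole j) ^ (2 * m + 1))"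
    unfolding even_kernel_Suc odd_kernel_Suc by simp
  also have "2 / pole j ^ 2 * (t / pole j) ^ (2 * m) = 2 * t ^ (2 * m) * (1 / pole j ^ (2 * m + 2))"
    by (simp add: power_divide power_add power2_eq_square)
  also have "2 / pole j ^ 3 * ((2 * real m + 3) * (t / pole j) ^ (2 * m + 1)) =
      2 * (2 * real m + 3) * t ^ (2 * m + 1) * (1 / pole j ^ (2 * m + 4))"
  proof -
    have "pole j ^ (2 * m + 4) = pole j ^ 3 * pole j ^ (2 * m + 1)"
      unfolding power_add[symmetric] by (simp add: numeral_eq_Suc)
    then show ?thesis by (simp add: power_divide)
  qed
  finally show ?thesis .
qed

lemma repeated_nonneg_integral_remainder_kernel:
  "repeated_nonneg_integral m (remainder_kernel m j)"
  unfolding remainder_kernel_def [abs_def]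
  by (intro repeated_nonneg_integral_add repeated_nonneg_integral_cmult
      repeated_nonneg_integral_rescale even_kernel_repeated odd_kernel_repeated pole_pos)
    (auto intro: divide_nonneg_pos less_imp_le pole_pos)

lemma remainder_kernel_measurable: "remainder_kernel m j \<in> borel_measurable borel"
  unfolding remainder_kernel_def even_kernel_def odd_kernel_def by measurable

lemma remainder_kernel_nonneg: "t \<ge> 0 \<Longrightarrow> 0 \<le> remainder_kernel m j t"
  using pole_pos[of j] unfolding remainder_kernel_def even_kernel_def odd_kernel_def
  by (intro add_nonneg_nonneg mult_nonneg_nonneg divide_nonneg_nonneg zero_le_power) auto

text \<open>An alternating-series estimate: the next kernel is nonnegative, so this one is at most
  the sum of both. Summability, convergence of the Laplace transform and the order of vanishing at 0
  all rest on it.\<close>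

lemma remainder_kernel_le:
  assumes "t \<ge> 0"
  shows "remainder_kernel m j t \<le> 2 * t ^ (2 * m) * (1 / pole j ^ (2 * m + 2)) +
     2 * (2 * real m + 3) * t ^ (2 * m + 1) * (1 / pole j ^ (2 * m + 4))"
  using remainder_kernel_Suc[of m j t] remainder_kernel_nonneg[OF assms, of "Suc m" j] by linarith

lemma remainder_kernel_bound_sums:
  "(\<lambda>j. 2 * t ^ (2 * m) * (1 / pole j ^ (2 * m + 2)) +
     2 * (2 * real m + 3) * t ^ (2 * m + 1) * (1 / pole j ^ (2 * m + 4))) sums
   (2 * t ^ (2 * m) * pole_sum (2 * m + 2) + 2 * (2 * real m + 3) * t ^ (2 * m + 1) * pole_sum (2 * m + 4))"
  by (intro sums_add sums_mult pole_sum_sums) auto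

lemma summable_remainder_kernel:
  assumes "t \<ge> 0"
  shows "summable (\<lambda>j. remainder_kernel m j t)"
  by (rule summable_comparison_test'[OF sums_summable[OF remainder_kernel_bound_sums[of t m]]])
    (use remainder_kernel_le[OF assms] remainder_kernel_nonneg[OF assms] in auto)

lemma suminf_remainder_kernel_le:
  assumes "t \<ge> 0"
  shows "(\<Sum>j. remainder_kernel m j t) \<le>
    2 * t ^ (2 * m) * pole_sum (2 * m + 2) + 2 * (2 * real m + 3) * t ^ (2 * m + 1) * pole_sum (2 * m + 4)"
  by (rule sums_le[OF remainder_kernel_le[OF assms] summable_sums[OF summable_remainder_kernel[OF assms]]
        remainder_kernel_bound_sums])

text \<open>With \<open>u = 1 - exp (- t)\<close>, the identity
  \<open>1/u^2 = 1/u + (1 - u)/u^2\<close> is \<open>b^2 = b - b'\<close>, so the two partial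
  fraction series are subtracted.\<close>

lemma remainder_kernel_0_sums:
  assumes t: "t > 0"
  shows "(\<lambda>j. t ^ 3 * remainder_kernel 0 j t) sums
    (t\<^sup>2 / (1 - exp (- t))\<^sup>2 - (1 + t + (1 / 2 - 2 * pole_sum 2) * t\<^sup>2))"
proof -
  \<comment> \<open>The last summand cancels the value \<open>-2 / pole j ^ 2\<close> that the other
    two have at \<open>t = 0\<close>; summed over \<open>j\<close>, it accounts for
    \<open>pole_sum 2\<close> in the quadratic coefficient.\<close>
  have kernel: "t ^ 3 * remainder_kernel 0 j t =
      t\<^sup>2 * (2 * t / (t\<^sup>2 + pole j ^ 2) - 2 * (pole j ^ 2 - t\<^sup>2) / (t\<^sup>2 + pole j ^ 2)\<^sup>2 + 2 * (1 / pole j ^ 2))" for j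
  proof -
    define a where "a = pole j"
    define d where "d = t\<^sup>2 + a\<^sup>2"
    have a: "a > 0" unfolding a_def by (rule pole_pos)
    have d: "d > 0" unfolding d_def a_def by (rule square_plus_pole_pos)
    have q: "1 + (t / a)\<^sup>2 = d / a\<^sup>2" using a by (simp add: d_def add_divide_distrib power_divide)
    have e: "even_kernel 0 (t / a) = a\<^sup>2 / d" unfolding even_kernel_def q by simp
    have o1: "odd_kernel 0 (t / a) = (t / a) * (3 + t\<^sup>2 / a\<^sup>2) / (d / a\<^sup>2)\<^sup>2"
      unfolding odd_kernel_def q by (simp add: power_divide)
    have o2: "2 / a ^ 3 * ((t / a) * (3 + t\<^sup>2 / a\<^sup>2) / (d / a\<^sup>2)\<^sup>2) = 2 * t * (3 * a\<^sup>2 + t\<^sup>2) / (a\<^sup>2 * d\<^sup>2)"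
    proof -
      have "3 + t\<^sup>2 / a\<^sup>2 = (3 * a\<^sup>2 + t\<^sup>2) / a\<^sup>2" using a by (simp add: add_divide_distrib)
      then show ?thesis using a d by (simp add: field_simps power_numeral_reduce)
    qed
    have "t ^ 3 * remainder_kernel 0 j t = t ^ 3 * (2 / d + 2 * t * (3 * a\<^sup>2 + t\<^sup>2) / (a\<^sup>2 * d\<^sup>2))"
      unfolding remainder_kernel_def a_def[symmetric] e o1 o2 using a by simp
    also have "\<dots> = t\<^sup>2 * (2 * t / d + 2 * t\<^sup>2 * (3 * a\<^sup>2 + t\<^sup>2) / (a\<^sup>2 * d\<^sup>2))"
      by (simp add: algebra_simps power_numeral_reduce)
    also have "2 * t\<^sup>2 * (3 * a\<^sup>2 + t\<^sup>2) / (a\<^sup>2 * d\<^sup>2) = 2 * (1 / a\<^sup>2) - 2 * (a\<^sup>2 - t\<^sup>2) / d\<^sup>2"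
    proof -
      have "2 * (1 / a\<^sup>2) - 2 * (a\<^sup>2 - t\<^sup>2) / d\<^sup>2 = (2 * d\<^sup>2 - 2 * (a\<^sup>2 - t\<^sup>2) * a\<^sup>2) / (a\<^sup>2 * d\<^sup>2)"
        using a d by (simp add: diff_divide_distrib)
      also have "2 * d\<^sup>2 - 2 * (a\<^sup>2 - t\<^sup>2) * a\<^sup>2 = 2 * t\<^sup>2 * (3 * a\<^sup>2 + t\<^sup>2)"
        unfolding d_def by (simp add: algebra_simps power2_eq_square)
      finally show ?thesis by simp
    qed
    finally show ?thesis unfolding d_def a_def by (simp add: algebra_simps)
  qed
  have "(\<lambda>j. t ^ 3 * remainder_kernel 0 j t) sums
    (t\<^sup>2 * ((1 / (1 - exp (- t)) - 1 / 2 - 1 / t) - (1 / t\<^sup>2 - exp (- t) / (1 - exp (- t))\<^sup>2) + 2 * pole_sum 2))"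
    unfolding kernel by (intro sums_mult sums_add sums_diff partial_fraction_1 partial_fraction_2 t pole_sum_sums) simp
  moreover have "t\<^sup>2 * ((1 / (1 - exp (- t)) - 1 / 2 - 1 / t) - (1 / t\<^sup>2 - exp (- t) / (1 - exp (- t))\<^sup>2) + 2 * pole_sum 2)
      = t\<^sup>2 / (1 - exp (- t))\<^sup>2 - (1 + t + (1 / 2 - 2 * pole_sum 2) * t\<^sup>2)"
  proof -
    have "1 / u + (1 - u) / u\<^sup>2 = 1 / u\<^sup>2" if "u > 0" for u :: real
      using that by (simp add: field_simps power2_eq_square)
    from this[of "1 - exp (- t)"] have "1 / (1 - exp (- t)) + exp (- t) / (1 - exp (- t))\<^sup>2 = 1 / (1 - exp (- t))\<^sup>2"
      using t by simp
    then have "t\<^sup>2 / (1 - exp (- t))\<^sup>2 = t\<^sup>2 * (1 / (1 - exp (- t)) + exp (- t) / (1 - exp (- t))\<^sup>2)" by simp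
    moreover have "t\<^sup>2 * (1 / t) = t" "t\<^sup>2 * (1 / t\<^sup>2) = 1" using t by (auto simp: power2_eq_square)
    ultimately show ?thesis by (simp only: algebra_simps)
  qed
  ultimately show ?thesis by (simp only:)
qed

text \<open>Induction on \<open>m\<close>: consecutive kernels add up to two monomials, which are moved into \<open>Q\<close>.\<close>

lemma remainder_kernel_sums:
  "\<exists>Q. degree Q \<le> 2 * m + 2 \<and> (\<forall>t>0. (\<lambda>j. t ^ 3 * remainder_kernel m j t) sums
     ((- 1) ^ m * (t\<^sup>2 / (1 - exp (- t))\<^sup>2 - poly Q t)))"
proof (induction m)
  case 0
  have "poly [:1, 1, 1 / 2 - 2 * pole_sum 2:] t = 1 + t + (1 / 2 - 2 * pole_sum 2) * t\<^sup>2" for t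
    by (simp add: algebra_simps power2_eq_square)
  then have "(\<lambda>j. t ^ 3 * remainder_kernel 0 j t) sums
     ((- 1) ^ 0 * (t\<^sup>2 / (1 - exp (- t))\<^sup>2 - poly [:1, 1, 1 / 2 - 2 * pole_sum 2:] t))" if "t > 0" for t
    using remainder_kernel_0_sums[OF that] by (simp only: power_0 mult_1)
  moreover have "degree [:1, 1, 1 / 2 - 2 * pole_sum 2:] \<le> 2 * 0 + 2" by simp
  ultimately show ?case by blast
next
  case (Suc m)
  then obtain Q where Q: "degree Q \<le> 2 * m + 2" "\<And>t. t > 0 \<Longrightarrow> (\<lambda>j. t ^ 3 * remainder_kernel m j t) sums
     ((- 1) ^ m * (t\<^sup>2 / (1 - exp (- t))\<^sup>2 - poly Q t))" by blast
  \<comment> \<open>The factor \<open>t ^ 3\<close> raises the exponents \<open>2m\<close> and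
    \<open>2m + 1\<close> to \<open>2m + 3\<close> and \<open>2m + 4\<close>, so the degree bound
    for \<open>Suc m\<close> is respected.\<close>
  define M where "M = monom (2 * pole_sum (2 * m + 2)) (2 * m + 3)
      + monom (2 * (2 * real m + 3) * pole_sum (2 * m + 4)) (2 * m + 4)"
  define Q' where "Q' = Q + smult ((- 1) ^ m) M"
  have "degree Q' \<le> 2 * Suc m + 2"
    unfolding Q'_def M_def using Q(1)
    by (intro degree_add_le order_trans[OF degree_smult_le] order_trans[OF degree_monom_le]) auto
  moreover have "(\<lambda>j. t ^ 3 * remainder_kernel (Suc m) j t) sums
     ((- 1) ^ Suc m * (t\<^sup>2 / (1 - exp (- t))\<^sup>2 - poly Q' t))" if t: "t > 0" for t
  proof -
    have "(\<lambda>j. t ^ 3 * (2 * t ^ (2 * m) * (1 / pole j ^ (2 * m + 2)) +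
     2 * (2 * real m + 3) * t ^ (2 * m + 1) * (1 / pole j ^ (2 * m + 4))) - t ^ 3 * remainder_kernel m j t) sums
     (t ^ 3 * (2 * t ^ (2 * m) * pole_sum (2 * m + 2) + 2 * (2 * real m + 3) * t ^ (2 * m + 1) * pole_sum (2 * m + 4))
       - (- 1) ^ m * (t\<^sup>2 / (1 - exp (- t))\<^sup>2 - poly Q t))"
      by (intro sums_diff sums_mult remainder_kernel_bound_sums Q(2) t)
    moreover have "t ^ 3 * (2 * t ^ (2 * m) * pole_sum (2 * m + 2) + 2 * (2 * real m + 3) * t ^ (2 * m + 1) * pole_sum (2 * m + 4))
       = poly M t"
    proof -
      have "t ^ (2 * m + 3) = t ^ 3 * t ^ (2 * m)" "t ^ (2 * m + 4) = t ^ 3 * t ^ (2 * m + 1)"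
        unfolding power_add[symmetric] by (simp_all add: numeral_eq_Suc)
      then show ?thesis unfolding M_def by (simp add: poly_monom algebra_simps)
    qed
    moreover have "poly M t - (- 1) ^ m * (X - poly Q t) = (- 1) ^ Suc m * (X - poly Q' t)" for X
    proof -
      have "(- 1) ^ m * ((- 1) ^ m * poly M t) = poly M t"
        by (simp add: mult.assoc[symmetric] power_mult_distrib[symmetric])
      then show ?thesis by (simp add: Q'_def algebra_simps)
    qed
    moreover have "t ^ 3 * (2 * t ^ (2 * m) * (1 / pole j ^ (2 * m + 2)) +
     2 * (2 * real m + 3) * t ^ (2 * m + 1) * (1 / pole j ^ (2 * m + 4))) - t ^ 3 * remainder_kernel m j t
       = t ^ 3 * remainder_kernel (Suc m) j t" for j
      unfolding remainder_kernel_Suc[symmetric] by (simp add: algebra_simps)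
    ultimately show ?thesis by (simp only:)
  qed
  ultimately show ?case by blast
qed

section \<open>Identification of the subtracted polynomial by its order of contact at 0\<close>

lemma fps_expansion_vanishing_coefficients:
  fixes h :: "real \<Rightarrow> real"
  assumes h: "h has_fps_expansion H"
    and bound: "\<And>x. -1 < x \<Longrightarrow> x < 0 \<Longrightarrow> \<bar>h x\<bar> \<le> C * \<bar>x\<bar> ^ Suc N"
    and "i \<le> N"
  shows "fps_nth H i = 0"
proof (rule ccontr)
  assume "fps_nth H i \<noteq> 0"
  \<comment> \<open>\<open>h x / x ^ r\<close> tends to the first nonzero coefficient of
    \<open>H\<close>, but the bound and \<open>r <= N\<close> force the limit 0. The limit is taken
    from the left because \<open>x\<close> will be \<open>- t\<close> with
    \<open>t > 0\<close>.\<close>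
  define r where "r = subdegree H"
  have H: "H \<noteq> 0" using \<open>fps_nth H i \<noteq> 0\<close> by auto
  have r: "r \<le> N" unfolding r_def using subdegree_leI[OF \<open>fps_nth H i \<noteq> 0\<close>] \<open>i \<le> N\<close> by simp
  let ?g = "\<lambda>x. if x = 0 then fps_nth H r else h x / x ^ r"
  have "?g has_fps_expansion fps_shift r H"
    by (rule has_fps_expansion_shift[OF h]) (simp_all add: r_def)
  then have "continuous (at 0 within {..<0}) ?g" by (rule has_fps_expansion_imp_continuous)
  then have lim: "(?g \<longlongrightarrow> fps_nth H r) (at_left 0)" by (simp add: continuous_within)
  have "(?g \<longlongrightarrow> 0) (at_left 0)"
  proof (rule Lim_null_comparison)
    have "eventually (\<lambda>x. x \<in> {-1<..<0::real}) (at_left 0)"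
      by (rule eventually_at_left_real) simp
    then show "eventually (\<lambda>x. norm (?g x) \<le> C * \<bar>x\<bar> ^ (Suc N - r)) (at_left 0)"
    proof (rule eventually_mono)
      fix x :: real assume x: "x \<in> {-1<..<0}"
      have "\<bar>x\<bar> ^ Suc N = \<bar>x\<bar> ^ (Suc N - r) * \<bar>x\<bar> ^ r"
        unfolding power_add[symmetric] using r by simp
      moreover have "\<bar>h x\<bar> \<le> C * \<bar>x\<bar> ^ Suc N"
        using x by (intro bound) auto
      ultimately have "\<bar>h x\<bar> \<le> C * \<bar>x\<bar> ^ (Suc N - r) * \<bar>x\<bar> ^ r"
        by (simp only: mult.assoc)
      then show "norm (?g x) \<le> C * \<bar>x\<bar> ^ (Suc N - r)"
        using x by (simp add: abs_divide power_abs pos_divide_le_eq)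
    qed
    have "((\<lambda>x. C * \<bar>x\<bar> ^ (Suc N - r)) \<longlongrightarrow> C * \<bar>0\<bar> ^ (Suc N - r)) (at_left (0::real))"
      by (intro tendsto_intros)
    then show "((\<lambda>x. C * \<bar>x\<bar> ^ (Suc N - r)) \<longlongrightarrow> 0) (at_left (0::real))"
      using r by (simp add: power_0_left)
  qed
  with lim have "fps_nth H r = 0" by (intro tendsto_unique[OF _ lim]) auto
  then show False using H by (simp add: r_def)
qed

text \<open>Numerator and denominator both have order 2 and leading coefficient 1, so the
  singularity at 0 is removable with value 1.\<close>

lemma double_bernoulli_expansion:
  "(\<lambda>x. if x = 0 then 1 else x\<^sup>2 / (exp x - 1)\<^sup>2)
     has_fps_expansion Abs_fps (\<lambda>k. double_bernoulli k / fact k)"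
proof -
  have fn1: "fps_nth (fps_exp (1::real) - 1) 1 = 1" by simp
  have sub1: "subdegree (fps_exp (1::real) - 1) = 1"
    by (rule subdegreeI) (auto simp: fn1)
  then have sub: "subdegree ((fps_exp (1::real) - 1) ^ 2) = 2" by (simp add: subdegree_power)
  have nz: "(fps_exp (1::real) - 1) ^ 2 \<noteq> 0" using sub by (metis subdegree_0 zero_neq_numeral)
  have c: "fps_nth ((fps_exp (1::real) - 1) ^ 2) 2 = 1"
    by (simp add: power2_eq_square fps_mult_nth numeral_2_eq_2)
  have "(\<lambda>x. if x = 0 then 1 else x\<^sup>2 / ((exp x - 1) * (exp x - 1))) has_fps_expansion
      fps_X ^ 2 / ((fps_exp (1::real) - 1) * (fps_exp 1 - 1))"
    by (rule has_fps_expansion_divide has_fps_expansion_fps_X_power has_fps_expansion_mult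
        has_fps_expansion_diff has_fps_expansion_exp1 has_fps_expansion_1)+
      (use sub nz c in \<open>simp_all add: power2_eq_square\<close>)
  also have "fps_X ^ 2 / ((fps_exp (1::real) - 1) * (fps_exp 1 - 1)) = Abs_fps (\<lambda>k. double_bernoulli k / fact k)"
    by (simp add: fps_eq_iff double_bernpoly_def power2_eq_square)
  finally show ?thesis unfolding power2_eq_square[of "exp _ - 1"] .
qed

text \<open>The substitution \<open>x = - t\<close> leads to the generating function of the double
  Bernoulli numbers, whence the signs \<open>(- 1) ^ k\<close>. Contact of order
  \<open>N + 1\<close> from one side then fixes all coefficients up to \<open>N\<close>.\<close>

lemma taylor_polynomial_unique:
  assumes deg: "degree Q \<le> N"
    and bound: "\<And>t. 0 < t \<Longrightarrow> t < 1 \<Longrightarrow> \<bar>t\<^sup>2 / (1 - exp (- t))\<^sup>2 - poly Q t\<bar> \<le> C * t ^ Suc N"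
  shows "poly Q t = (\<Sum>k=0..N. (- 1) ^ k / fact k * double_bernoulli k * t ^ k)"
proof -
  define R where "R = pcompose Q [:0, -1:]"
  have R: "poly R x = poly Q (- x)" for x by (simp add: R_def poly_pcompose)
  let ?a = "\<lambda>x::real. if x = 0 then 1 else x\<^sup>2 / (exp x - 1)\<^sup>2"
  have "(\<lambda>x. poly R x) has_fps_expansion fps_of_poly R"
    by (simp add: has_fps_expansion_def)
  then have h: "(\<lambda>x. ?a x - poly R x) has_fps_expansion
      Abs_fps (\<lambda>k. double_bernoulli k / fact k) - fps_of_poly R"
    by (rule has_fps_expansion_diff[OF double_bernoulli_expansion])
  have hb: "\<bar>?a x - poly R x\<bar> \<le> C * \<bar>x\<bar> ^ Suc N" if "-1 < x" "x < 0" for x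
  proof -
    have "?a x = (- x)\<^sup>2 / (1 - exp (- (- x)))\<^sup>2"
      using that by (simp add: power2_commute)
    then show ?thesis using bound[of "- x"] that by (simp only: R) simp
  qed
  have coeff: "coeff Q k = (- 1) ^ k / fact k * double_bernoulli k" if "k \<le> N" for k
  proof -
    have "double_bernoulli k / fact k = (- 1) ^ k * coeff Q k"
      using fps_expansion_vanishing_coefficients[OF h hb that]
      by (simp add: R_def coeff_pcompose_linear)
    then have "(- 1) ^ k * (double_bernoulli k / fact k) = coeff Q k"
      by (simp add: mult.assoc[symmetric] power_mult_distrib[symmetric])
    then show ?thesis by simp
  qed
  have "poly Q t = (\<Sum>k\<le>N. coeff Q k * t ^ k)"
    unfolding poly_altdef using deg by (intro sum.mono_neutral_left) (auto simp: coeff_eq_0)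
  also have "\<dots> = (\<Sum>k=0..N. (- 1) ^ k / fact k * double_bernoulli k * t ^ k)"
    unfolding atMost_atLeast0 by (intro sum.cong refl) (simp add: coeff)
  finally show ?thesis .
qed

text \<open>\<open>remainder_kernel_sums\<close> leaves \<open>Q\<close> unspecified; the kernel
  estimates give a difference of size \<open>O(t^(2m+3))\<close> at 0, so \<open>Q\<close> must be
  the Taylor polynomial.\<close>

theorem remainder_integrand_series:
  assumes t: "t > 0"
  shows "(\<lambda>j. remainder_kernel m j t) sums
    ((- 1) ^ m * (1 / t ^ 3 * (t\<^sup>2 / (1 - exp (- t))\<^sup>2 -
       (\<Sum>k=0..2 * m + 2. (- 1) ^ k / fact k * double_bernoulli k * t ^ k))))"
proof -
  obtain Q where Q: "degree Q \<le> 2 * m + 2" "\<And>t. t > 0 \<Longrightarrow> (\<lambda>j. t ^ 3 * remainder_kernel m j t) sums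
     ((- 1) ^ m * (t\<^sup>2 / (1 - exp (- t))\<^sup>2 - poly Q t))" using remainder_kernel_sums[of m] by blast
  \<comment> \<open>For \<open>0 < t < 1\<close> the power \<open>t^(2m+1)\<close> is at most
    \<open>t^(2m)\<close>, so the two coefficients of \<open>suminf_remainder_kernel_le\<close> can
    be added.\<close>
  define C where "C = 2 * pole_sum (2 * m + 2) + 2 * (2 * real m + 3) * pole_sum (2 * m + 4)"
  have ps: "pole_sum i \<ge> 0" if "i \<ge> 2" for i
    unfolding pole_sum_def by (intro suminf_nonneg summable_inverse_pole_power that) (simp add: less_imp_le pole_pos)
  have bound: "\<bar>t\<^sup>2 / (1 - exp (- t))\<^sup>2 - poly Q t\<bar> \<le> C * t ^ Suc (2 * m + 2)" if "0 < t" "t < 1" for t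
  proof -
    let ?P = "\<Sum>j. remainder_kernel m j t"
    have "(\<lambda>j. t ^ 3 * remainder_kernel m j t) sums (t ^ 3 * ?P)"
      by (intro sums_mult summable_sums summable_remainder_kernel) (use that in simp)
    then have "t ^ 3 * ?P = (- 1) ^ m * (t\<^sup>2 / (1 - exp (- t))\<^sup>2 - poly Q t)"
      using Q(2)[OF that(1)] by (rule sums_unique2)
    then have "\<bar>t\<^sup>2 / (1 - exp (- t))\<^sup>2 - poly Q t\<bar> = \<bar>t ^ 3 * ?P\<bar>" by (simp add: abs_mult power_abs)
    also have "\<dots> = t ^ 3 * ?P"
      using that suminf_nonneg[OF summable_remainder_kernel[of t m]] remainder_kernel_nonneg[of t m] by simp
    also have "?P \<le> C * t ^ (2 * m)"
    proof -
      have "t ^ (2 * m + 1) \<le> t ^ (2 * m)" using that by (intro power_decreasing) auto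
      then have "2 * (2 * real m + 3) * t ^ (2 * m + 1) * pole_sum (2 * m + 4) \<le>
          2 * (2 * real m + 3) * t ^ (2 * m) * pole_sum (2 * m + 4)"
        by (intro mult_right_mono mult_left_mono ps) auto
      then show ?thesis using suminf_remainder_kernel_le[of t m] that
        unfolding C_def by (simp add: algebra_simps)
    qed
    then have "t ^ 3 * ?P \<le> t ^ 3 * (C * t ^ (2 * m))" using that by (intro mult_left_mono) auto
    also have "\<dots> = C * t ^ Suc (2 * m + 2)"
    proof -
      have "t ^ Suc (2 * m + 2) = t ^ 3 * t ^ (2 * m)"
        unfolding power_add[symmetric] by (simp add: numeral_eq_Suc)
      then show ?thesis by (simp only: mult.left_commute)
    qed
    finally show ?thesis by simp
  qed
  have "(\<lambda>j. 1 / t ^ 3 * (t ^ 3 * remainder_kernel m j t)) sums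
     (1 / t ^ 3 * ((- 1) ^ m * (t\<^sup>2 / (1 - exp (- t))\<^sup>2 - poly Q t)))"
    by (intro sums_mult Q(2) t)
  moreover have "1 / t ^ 3 * (t ^ 3 * y) = y" for y using t by simp
  moreover have "poly Q t = (\<Sum>k=0..2 * m + 2. (- 1) ^ k / fact k * double_bernoulli k * t ^ k)"
    by (rule taylor_polynomial_unique[OF Q(1) bound])
  ultimately show ?thesis by (simp only: mult.left_commute[of "1 / t ^ 3"])
qed

section \<open>The remainder as a Laplace transform\<close>

lemma laplace_weight_indicator: "laplace_weight (indicator {0..})"
  unfolding laplace_weight_def
proof (intro conjI allI impI)
  fix x :: real assume x: "x > 0"
  have "integrable lborel (\<lambda>t. 1 / x * (x * exp (- x * t) * indicator {0..} t))"
  proof (intro integrable_mult_right integrableI_nonneg)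
    have "(\<integral>\<^sup>+t. ennreal (x * exp (- x * t) * indicator {0..} t) \<partial>lborel) = ennreal (exp (- x * 0))"
      unfolding nn_integral_exp_tail[OF x, symmetric] by (intro nn_integral_cong) (simp split: split_indicator)
    then show "(\<integral>\<^sup>+t. ennreal (x * exp (- x * t) * indicator {0..} t) \<partial>lborel) < \<infinity>" by simp
  qed (use x in auto)
  then show "integrable lborel (\<lambda>t. exp (- x * t) * indicator {0..} t)"
    using x by simp
qed auto

lemma laplace_nn_remainder_finite:
  assumes x: "x > 0"
  shows "laplace_nn (\<lambda>t. \<Sum>j. remainder_kernel m j t) x < \<infinity>"
proof -
  define A where "A = 2 * pole_sum (2 * m + 2)"
  define B where "B = 2 * (2 * real m + 3) * pole_sum (2 * m + 4)"
  define J where "J t = A * (exp (- x * t) * (t ^ (2 * m) * indicator {0..} t)) +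
      B * (exp (- x * t) * (t ^ (2 * m + 1) * indicator {0..} t))" for t
  have "integrable lborel (\<lambda>t. exp (- x * t) * (t ^ i * indicator {0..} t))" for i
    using laplace_weight_power[OF laplace_weight_indicator, of i] x unfolding laplace_weight_def by blast
  then have "integrable lborel J" unfolding J_def [abs_def]
    by (intro Bochner_Integration.integrable_add integrable_mult_right)
  then have "(\<integral>\<^sup>+t. ennreal (norm (J t)) \<partial>lborel) < \<infinity>"
    by (simp only: integrable_iff_bounded)
  moreover have "laplace_nn (\<lambda>t. \<Sum>j. remainder_kernel m j t) x \<le> (\<integral>\<^sup>+t. ennreal (norm (J t)) \<partial>lborel)"
    unfolding laplace_nn_def
  proof (rule nn_integral_mono)
    fix t :: real
    show "ennreal (exp (- x * t) * (\<Sum>j. remainder_kernel m j t)) * indicator {0..} t \<le> ennreal (norm (J t))"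
    proof (cases "t \<ge> 0")
      case True
      have "exp (- x * t) * (\<Sum>j. remainder_kernel m j t) \<le>
          exp (- x * t) * (2 * t ^ (2 * m) * pole_sum (2 * m + 2) +
            2 * (2 * real m + 3) * t ^ (2 * m + 1) * pole_sum (2 * m + 4))"
        by (intro mult_left_mono suminf_remainder_kernel_le True) simp
      also have "\<dots> = J t" using True by (simp add: J_def A_def B_def algebra_simps)
      also have "\<dots> \<le> norm (J t)" by simp
      finally show ?thesis using True by (simp add: ennreal_leI)
    qed simp
  qed
  ultimately show ?thesis by (rule le_less_trans[rotated])
qed

text \<open>The sign \<open>(- 1) ^ m\<close> makes the integrand nonnegative, so the Lebesgue
  integral is \<open>enn2real\<close> of the nonnegative one. If the integral diverges, both sides
  are 0 by default.\<close>

lemma double_gamma_remainder_laplace: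
  "(- 1) ^ m * double_gamma_remainder (2 * m + 2) x =
     enn2real (laplace_nn (\<lambda>t. \<Sum>j. remainder_kernel m j t) x)"
proof -
  let ?P = "\<lambda>t. \<Sum>j. remainder_kernel m j t"
  have [measurable]: "remainder_kernel m j \<in> borel_measurable borel" for j
    by (rule remainder_kernel_measurable)
  have P0: "0 \<le> ?P t" if "t \<ge> 0" for t
    by (intro suminf_nonneg summable_remainder_kernel remainder_kernel_nonneg that)
  have "indicator {0<..} t *\<^sub>R (exp (- x * t) / t ^ 3 *
        (t ^ 2 / (1 - exp (- t)) ^ 2 -
         (\<Sum>k=0..2 * m + 2. (- 1) ^ k / fact k * double_bernoulli k * t ^ k))) =
      (- 1) ^ m * (indicator {0<..} t * (exp (- x * t) * ?P t))" for t
  proof (cases "t > 0")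
    case True
    have "(- 1) ^ m * ?P t = 1 / t ^ 3 * (t\<^sup>2 / (1 - exp (- t))\<^sup>2 -
       (\<Sum>k=0..2 * m + 2. (- 1) ^ k / fact k * double_bernoulli k * t ^ k))"
      using remainder_integrand_series[OF True, of m] unfolding sums_iff
      by (simp add: mult.assoc[symmetric] power_mult_distrib[symmetric])
    then have "exp (- x * t) * ((- 1) ^ m * ?P t) = exp (- x * t) / t ^ 3 * (t\<^sup>2 / (1 - exp (- t))\<^sup>2 -
       (\<Sum>k=0..2 * m + 2. (- 1) ^ k / fact k * double_bernoulli k * t ^ k))"
      by (simp only:) simp
    then show ?thesis using True by (simp add: mult.left_commute)
  qed simp
  then have "double_gamma_remainder (2 * m + 2) x =
      (LINT t|lborel. (- 1) ^ m * (indicator {0<..} t * (exp (- x * t) * ?P t)))"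
    unfolding double_gamma_remainder_def set_lebesgue_integral_def by (simp only:)
  also have "\<dots> = (- 1) ^ m * (LINT t|lborel. indicator {0<..} t * (exp (- x * t) * ?P t))"
    by (rule integral_mult_right_zero)
  finally have "(- 1) ^ m * double_gamma_remainder (2 * m + 2) x =
      (LINT t|lborel. indicator {0<..} t * (exp (- x * t) * ?P t))"
    by (simp add: mult.assoc[symmetric] power_mult_distrib[symmetric])
  also have "\<dots> = enn2real (\<integral>\<^sup>+t. ennreal (indicator {0<..} t * (exp (- x * t) * ?P t)) \<partial>lborel)"
    by (rule integral_eq_nn_integral) (auto simp: indicator_def P0)
  also have "(\<integral>\<^sup>+t. ennreal (indicator {0<..} t * (exp (- x * t) * ?P t)) \<partial>lborel) = laplace_nn ?P x"
    unfolding laplace_nn_def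
  proof (rule nn_integral_cong_AE)
    have "AE t in lborel. t \<noteq> (0::real)" by (rule AE_lborel_singleton)
    then show "AE t in lborel. ennreal (indicator {0<..} t * (exp (- x * t) * ?P t)) =
        ennreal (exp (- x * t) * ?P t) * indicator {0..} t"
      by eventually_elim (auto simp: indicator_def)
  qed
  finally show ?thesis .
qed

theorem theorem4p1:
  fixes k n :: nat
  assumes "n \<ge> k + 1"
  shows "completely_monotonic_of_order (real k)
           (\<lambda>x. (- 1) ^ (n - 1) * double_gamma_remainder (2 * n) x)"
proof -
  define m where "m = n - 1"
  have n: "2 * n = 2 * m + 2" and k: "k \<le> m" using assms by (auto simp: m_def)
  show ?thesis
    unfolding completely_monotonic_of_order_def n m_def[symmetric]
  proof (rule completely_monotonic_laplace_series[where p = "remainder_kernel m"])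
    \<comment> \<open>Here \<open>n >= k + 1\<close> enters: the kernels admit
      \<open>m = n - 1\<close> differentiations, and the smaller order \<open>k\<close> is
      inherited.\<close>
    show "repeated_nonneg_integral k (remainder_kernel m j)" for j
      by (rule repeated_nonneg_integral_mono[OF repeated_nonneg_integral_remainder_kernel k])
    show "(\<lambda>j. remainder_kernel m j t) sums (\<Sum>j. remainder_kernel m j t)" if "t > 0" for t
      using that by (intro summable_sums summable_remainder_kernel) simp
    show "x powr real k * ((- 1) ^ m * double_gamma_remainder (2 * m + 2) x) =
        x ^ k * enn2real (laplace_nn (\<lambda>t. \<Sum>j. remainder_kernel m j t) x)" if "x > 0" for x
      using that by (simp only: double_gamma_remainder_laplace powr_realpow)
  qed (rule remainder_kernel_measurable laplace_nn_remainder_finite, assumption?)+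
qed

end
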